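(* Let $Y \in \mathcal{D}'$ and let $R = Y*$ be a convolution operator satisfying the condition of pseudo-passivity with $\vec{d} = \vec{0}$; that is, there exist a number $N \in \mathbb{N}_0$ and a vector $\vec{c} = (c_0,\ldots,c_N) \in \mathbb{R}^{N+1}$ such that for any $t \in \mathbb{R}$ and any test function $\varphi \in \mathcal{D}$ it holds that $R(\iota(\varphi)) \in \iota(L^1_{\mathrm{loc}})$ and $$\mathrm{Re}\left[\int_{-\infty}^t \overline{\varphi(\tau)}\,\psi(\tau)\,d\tau\right] \geq \sum_{j=0}^{N} c_j \int_{-\infty}^t |\varphi^{(j)}(\tau)|^2\,d\tau, \qquad \psi := \iota^{-1}(R(\iota(\varphi))).$$ Then $R$ also satisfies the conditions of causality, i.e. $\mathrm{supp}(Y) \subseteq [0,\infty)$, and slow growth, i.e. $Y \in \mathcal{S}'$.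
   Context: $\mathcal{D} = C_0^\infty(\mathbb{R},\mathbb{C})$ is the space of test functions and $\mathcal{D}'$ the space of distributions on $\mathbb{R}$; $\mathcal{S}'$ is the space of Schwartz (tempered) distributions. $L^1_{\mathrm{loc}} = L^1_{\mathrm{loc}}(\mathbb{R},\mathbb{C})$, and $\iota\colon L^1_{\mathrm{loc}} \hookrightarrow \mathcal{D}'$ is the inclusion $f \mapsto T_f$, $\langle T_f,\varphi\rangle = \int_{\mathbb{R}} f(t)\varphi(t)\,dt$ (no complex conjugation). A convolution operator $R = Y*$ with defining distribution $Y \in \mathcal{D}'$ is the operator $U \mapsto Y*U$, with the largest possible domain of definition; the domain contains at least all compactly supported distributions. *)

theory Defs
  imports "HOL-Analysis.Analysis" "HOL-Library.FuncSet"
begin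

subsection \<open>Test functions and distributions on the real line\<close>

definition nth_deriv :: "nat \<Rightarrow> (real \<Rightarrow> complex) \<Rightarrow> real \<Rightarrow> complex" where
  "nth_deriv n f = ((\<lambda>g x. vector_derivative g (at x)) ^^ n) f"

definition smooth :: "(real \<Rightarrow> complex) \<Rightarrow> bool" where
  "smooth f \<longleftrightarrow> (\<forall>n x. nth_deriv n f differentiable (at x))"

definition fun_support :: "('a::topological_space \<Rightarrow> complex) \<Rightarrow> 'a set" where
  "fun_support f = closure {x. f x \<noteq> 0}"

definition test_functions :: "(real \<Rightarrow> complex) set" where
  "test_functions = {\<phi>. smooth \<phi> \<and> compact (fun_support \<phi>)}"

definition tendsto_test ::
  "(nat \<Rightarrow> real \<Rightarrow> complex) \<Rightarrow> (real \<Rightarrow> complex) \<Rightarrow> bool" where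
  "tendsto_test \<Phi> \<phi> \<longleftrightarrow>
     (\<forall>n. \<Phi> n \<in> test_functions) \<and> \<phi> \<in> test_functions \<and>
     (\<exists>K. compact K \<and> (\<forall>n. fun_support (\<Phi> n) \<subseteq> K)) \<and>
     (\<forall>k. uniform_limit UNIV (\<lambda>n. nth_deriv k (\<Phi> n)) (nth_deriv k \<phi>) sequentially)"

definition linear_functional_on ::
  "(real \<Rightarrow> complex) set \<Rightarrow> ((real \<Rightarrow> complex) \<Rightarrow> complex) \<Rightarrow> bool" where
  "linear_functional_on V T \<longleftrightarrow>
     (\<forall>\<phi>\<in>V. \<forall>\<theta>\<in>V. T (\<lambda>x. \<phi> x + \<theta> x) = T \<phi> + T \<theta>) \<and>
     (\<forall>a. \<forall>\<phi>\<in>V. T (\<lambda>x. a * \<phi> x) = a * T \<phi>)"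

text \<open>Functionals are extensional, so that HOL equality of distributions is
  equality on all test functions. A linear functional on the space of test functions
  is continuous iff it is sequentially continuous.\<close>

definition distributions :: "((real \<Rightarrow> complex) \<Rightarrow> complex) set" where
  "distributions = {T \<in> extensional test_functions.
     linear_functional_on test_functions T \<and>
     (\<forall>\<Phi> \<phi>. tendsto_test \<Phi> \<phi> \<longrightarrow> (\<lambda>n. T (\<Phi> n)) \<longlonglongrightarrow> T \<phi>)}"

definition dist_support :: "((real \<Rightarrow> complex) \<Rightarrow> complex) \<Rightarrow> real set" where
  "dist_support T =
     - \<Union>{V. open V \<and> (\<forall>\<phi>\<in>test_functions. fun_support \<phi> \<subseteq> V \<longrightarrow> T \<phi> = 0)}"

definition L1_loc :: "(real \<Rightarrow> complex) set" where
  "L1_loc = {f. \<forall>K. compact K \<longrightarrow> f absolutely_integrable_on K}"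

definition dist_of :: "(real \<Rightarrow> complex) \<Rightarrow> (real \<Rightarrow> complex) \<Rightarrow> complex" where
  "dist_of f = (\<lambda>\<phi>\<in>test_functions. LINT t|lebesgue. f t * \<phi> t)"


subsection \<open>Tempered distributions\<close>

definition schwartz_functions :: "(real \<Rightarrow> complex) set" where
  "schwartz_functions =
     {\<phi>. smooth \<phi> \<and> (\<forall>j k. bounded (range (\<lambda>x. (x ^ j) *\<^sub>R nth_deriv k \<phi> x)))}"

definition tendsto_schwartz ::
  "(nat \<Rightarrow> real \<Rightarrow> complex) \<Rightarrow> (real \<Rightarrow> complex) \<Rightarrow> bool" where
  "tendsto_schwartz \<Phi> \<phi> \<longleftrightarrow>
     (\<forall>n. \<Phi> n \<in> schwartz_functions) \<and> \<phi> \<in> schwartz_functions \<and>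
     (\<forall>j k. uniform_limit UNIV (\<lambda>n x. (x ^ j) *\<^sub>R nth_deriv k (\<Phi> n) x)
              (\<lambda>x. (x ^ j) *\<^sub>R nth_deriv k \<phi> x) sequentially)"

definition schwartz_dual :: "((real \<Rightarrow> complex) \<Rightarrow> complex) set" where
  "schwartz_dual = {T \<in> extensional schwartz_functions.
     linear_functional_on schwartz_functions T \<and>
     (\<forall>\<Phi> \<phi>. tendsto_schwartz \<Phi> \<phi> \<longrightarrow> (\<lambda>n. T (\<Phi> n)) \<longlonglongrightarrow> T \<phi>)}"

text \<open>The dual of the Schwartz space, embedded in the distributions by restriction
  to the test functions.\<close>

definition tempered_distributions :: "((real \<Rightarrow> complex) \<Rightarrow> complex) set" where
  "tempered_distributions = (\<lambda>T. restrict T test_functions) ` schwartz_dual"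


subsection \<open>Convolution operators\<close>

text \<open>The convolution with its largest domain of definition, following Vladimirov:
  \<open>\<langle>Y * U, \<phi>\<rangle> = \<langle>Y(x) \<otimes> U(y), \<phi>(x + y)\<rangle>\<close>. Since \<open>\<phi>(x + y)\<close> is not compactly
  supported in the plane, the right-hand side is understood as the limit of
  \<open>\<langle>Y(x) \<otimes> U(y), \<eta>\<^sub>k(x, y) \<phi>(x + y)\<rangle>\<close>, which has to exist for all sequences \<open>\<eta>\<^sub>k\<close> of
  test functions on the plane converging to 1, and to be independent of the sequence.
  If \<open>U\<close> has compact support, the limit always exists and equals
  \<open>\<langle>Y(x), \<langle>U(y), \<phi>(x + y)\<rangle>\<rangle>\<close>.\<close>

definition partial_derivs ::
  "(real \<times> real) list \<Rightarrow> (real \<times> real \<Rightarrow> complex) \<Rightarrow> real \<times> real \<Rightarrow> complex" where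
  "partial_derivs vs f = foldr (\<lambda>v g z. frechet_derivative g (at z) v) vs f"

definition test_functions_plane :: "(real \<times> real \<Rightarrow> complex) set" where
  "test_functions_plane = {\<eta>. compact (fun_support \<eta>) \<and>
     (\<forall>vs\<in>lists Basis. \<forall>z. partial_derivs vs \<eta> differentiable (at z))}"

definition unit_sequence :: "(nat \<Rightarrow> real \<times> real \<Rightarrow> complex) \<Rightarrow> bool" where
  "unit_sequence \<eta> \<longleftrightarrow>
     (\<forall>k. \<eta> k \<in> test_functions_plane) \<and>
     (\<forall>K. compact K \<longrightarrow> (\<forall>\<^sub>F k in sequentially. \<forall>z\<in>K. \<eta> k z = 1)) \<and>
     (\<forall>vs\<in>lists Basis. \<exists>C. \<forall>k z. norm (partial_derivs vs (\<eta> k) z) \<le> C)"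

definition is_convolution ::
  "((real \<Rightarrow> complex) \<Rightarrow> complex) \<Rightarrow> ((real \<Rightarrow> complex) \<Rightarrow> complex) \<Rightarrow>
   ((real \<Rightarrow> complex) \<Rightarrow> complex) \<Rightarrow> bool" where
  "is_convolution Y U W \<longleftrightarrow> W \<in> distributions \<and>
     (\<forall>\<phi>\<in>test_functions. \<forall>\<eta>. unit_sequence \<eta> \<longrightarrow>
        (\<lambda>k. Y (\<lambda>x. U (\<lambda>y. \<eta> k (x, y) * \<phi> (x + y)))) \<longlonglongrightarrow> W \<phi>)"

definition convolution_operator ::
  "((real \<Rightarrow> complex) \<Rightarrow> complex) \<Rightarrow>
   ((real \<Rightarrow> complex) \<Rightarrow> complex) \<rightharpoonup> ((real \<Rightarrow> complex) \<Rightarrow> complex)" where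
  "convolution_operator Y U =
     (if U \<in> distributions \<and> (\<exists>W. is_convolution Y U W)
      then Some (THE W. is_convolution Y U W) else None)"


subsection \<open>Pseudo-passivity\<close>

text \<open>The function \<open>\<psi>\<close> is determined by \<open>R (dist_of \<phi>) = Some (dist_of \<psi>)\<close> up to a
  null set, which does not affect the inequality.\<close>

definition pseudo_passive_d0 ::
  "(((real \<Rightarrow> complex) \<Rightarrow> complex) \<rightharpoonup> ((real \<Rightarrow> complex) \<Rightarrow> complex)) \<Rightarrow> bool" where
  "pseudo_passive_d0 R \<longleftrightarrow>
     (\<exists>(N::nat) (c::nat \<Rightarrow> real). \<forall>t. \<forall>\<phi>\<in>test_functions. \<exists>\<psi>\<in>L1_loc.
        R (dist_of \<phi>) = Some (dist_of \<psi>) \<and>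
        Re (LINT \<tau>:{..t}|lebesgue. cnj (\<phi> \<tau>) * \<psi> \<tau>)
          \<ge> (\<Sum>j\<le>N. c j * (LINT \<tau>:{..t}|lebesgue. (cmod (nth_deriv j \<phi> \<tau>))\<^sup>2)))"

end

theory Submission
  imports "HOL-Computational_Algebra.Polynomial" Defs
begin

text \<open>Inserting \<open>f + \<lambda> g\<close>, with \<open>f\<close> supported in \<open>(0, \<infinity>)\<close> and \<open>g\<close> in
  \<open>(-\<infinity>, 0]\<close>, into the inequality at \<open>t = 0\<close> and letting \<open>\<lambda> \<rightarrow> 0\<close> gives
  \<open>\<langle>Y * f, cnj g\<rangle> = 0\<close>, hence causality. For large \<open>t\<close> the inequality is a positivity
  statement for a translation invariant sesquilinear form; combined with causality, a
  Cauchy--Schwarz argument bounds \<open>\<langle>Y * f, g\<rangle>\<close> uniformly in the position of \<open>g\<close> to the right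
  of \<open>f\<close>. Mollifying twice with a kernel having enough vanishing moments turns this into a
  bound of \<open>Y\<close> by \<open>C\<^sup>M\<close> norms that is uniform over all intervals of length two, and summing over
  a smooth partition of unity extends \<open>Y\<close> continuously to the Schwartz functions.\<close>

subsection \<open>Calculus of smooth functions\<close>

text \<open>The sharp cut-off at \<open>t\<close> is the obstacle: passivity speaks about
  \<open>Y\<close> on test functions only when cutting the tested function at \<open>t\<close>
  leaves a test function. Two choices work: a cut between the supports of two summands, which gives
  causality, and a cut to the right of the whole support, which gives the quadratic inequality.
  Since the \<open>c j\<close> may be negative, that form need not be positive; but its defect is
  controlled by derivative bounds and the lengths of the supports, neither of which changes when one
  factor is translated. The price is a finite order in both factors: when \<open>g\<close> is
  approximated by \<open>corr f g\<close> with \<open>f\<close> of width \<open>2 ^ -j\<close>, the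
  norms of \<open>f\<close> blow up. The vanishing moments pay for this, because successive
  mollifiers then differ by a high derivative, which integration by parts moves to \<open>g\<close>
  at the gain of a power of \<open>2 ^ -j\<close>. Causality returns at the end: the partition of
  unity has to cover only a half line, since the leftover lies where \<open>Y\<close>
  vanishes.\<close>

lemma nth_deriv_0 [simp]: "nth_deriv 0 f = f"
  by (simp add: nth_deriv_def)

lemma nth_deriv_Suc: "nth_deriv (Suc n) f = (\<lambda>x. vector_derivative (nth_deriv n f) (at x))"
  by (simp add: nth_deriv_def)

text \<open>Exhibiting all derivatives at once as an explicit family yields smoothness and the
  formula for \<open>nth_deriv\<close> together; the closure properties of \<open>smooth\<close>
  below are instances.\<close>

definition deriv_seq :: "(nat \<Rightarrow> real \<Rightarrow> complex) \<Rightarrow> bool" where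
  "deriv_seq F \<longleftrightarrow> (\<forall>n x. (F n has_vector_derivative F (Suc n) x) (at x))"

lemma deriv_seqI: "(\<And>n x. (F n has_vector_derivative F (Suc n) x) (at x)) \<Longrightarrow> deriv_seq F"
  by (simp add: deriv_seq_def)

lemma deriv_seq_nth_deriv:
  assumes "deriv_seq F"
  shows "nth_deriv n (F 0) = F n"
proof (induction n)
  case (Suc n)
  have "vector_derivative (F n) (at x) = F (Suc n) x" for x
    using assms by (intro vector_derivative_at) (auto simp: deriv_seq_def)
  with Suc show ?case
    by (simp add: nth_deriv_Suc)
qed simp

lemma deriv_seq_smooth: "deriv_seq F \<Longrightarrow> smooth (F 0)"
  by (simp add: smooth_def deriv_seq_nth_deriv)
    (metis deriv_seq_def differentiableI_vector)

lemma smooth_has_vector_derivative: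
  "smooth f \<Longrightarrow> (nth_deriv n f has_vector_derivative nth_deriv (Suc n) f x) (at x)"
  by (simp add: smooth_def nth_deriv_Suc vector_derivative_works)

lemma smooth_continuous: "smooth f \<Longrightarrow> continuous_on A (nth_deriv n f)"
  by (meson continuous_at_imp_continuous_on has_vector_derivative_continuous
      smooth_has_vector_derivative)

lemma smooth_continuous_0: "smooth f \<Longrightarrow> continuous_on A f"
  using smooth_continuous[of f A 0] by simp

lemma smooth_nth_deriv:
  assumes "smooth f"
  shows "smooth (nth_deriv m f)" "nth_deriv n (nth_deriv m f) = nth_deriv (m + n) f"
proof -
  have *: "deriv_seq (\<lambda>n. nth_deriv (m + n) f)"
    using smooth_has_vector_derivative[OF assms] by (intro deriv_seqI) simp
  show "smooth (nth_deriv m f)" "nth_deriv n (nth_deriv m f) = nth_deriv (m + n) f"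
    using deriv_seq_smooth[OF *] deriv_seq_nth_deriv[OF *, of n] by simp_all
qed

lemma smooth_add:
  assumes "smooth f" "smooth g"
  shows "smooth (\<lambda>x. f x + g x)"
    "nth_deriv n (\<lambda>x. f x + g x) = (\<lambda>x. nth_deriv n f x + nth_deriv n g x)"
proof -
  have *: "deriv_seq (\<lambda>n x. nth_deriv n f x + nth_deriv n g x)"
    using assms by (intro deriv_seqI has_vector_derivative_add smooth_has_vector_derivative)
  show "smooth (\<lambda>x. f x + g x)"
    "nth_deriv n (\<lambda>x. f x + g x) = (\<lambda>x. nth_deriv n f x + nth_deriv n g x)"
    using deriv_seq_smooth[OF *] deriv_seq_nth_deriv[OF *, of n] by simp_all
qed

lemma smooth_cmult:
  assumes "smooth f"
  shows "smooth (\<lambda>x. c * f x)" "nth_deriv n (\<lambda>x. c * f x) = (\<lambda>x. c * nth_deriv n f x)"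
proof -
  have *: "deriv_seq (\<lambda>n x. c * nth_deriv n f x)"
    using assms by (intro deriv_seqI has_vector_derivative_mult_right smooth_has_vector_derivative)
  show "smooth (\<lambda>x. c * f x)" "nth_deriv n (\<lambda>x. c * f x) = (\<lambda>x. c * nth_deriv n f x)"
    using deriv_seq_smooth[OF *] deriv_seq_nth_deriv[OF *, of n] by simp_all
qed

lemma smooth_diff:
  assumes "smooth f" "smooth g"
  shows "smooth (\<lambda>x. f x - g x)"
    "nth_deriv n (\<lambda>x. f x - g x) = (\<lambda>x. nth_deriv n f x - nth_deriv n g x)"
proof -
  have *: "deriv_seq (\<lambda>n x. nth_deriv n f x - nth_deriv n g x)"
    using assms by (intro deriv_seqI has_vector_derivative_diff smooth_has_vector_derivative)
  show "smooth (\<lambda>x. f x - g x)"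
    "nth_deriv n (\<lambda>x. f x - g x) = (\<lambda>x. nth_deriv n f x - nth_deriv n g x)"
    using deriv_seq_smooth[OF *] deriv_seq_nth_deriv[OF *, of n] by simp_all
qed

lemma smooth_cnj:
  assumes "smooth f"
  shows "smooth (\<lambda>x. cnj (f x))" "nth_deriv n (\<lambda>x. cnj (f x)) = (\<lambda>x. cnj (nth_deriv n f x))"
proof -
  have *: "deriv_seq (\<lambda>n x. cnj (nth_deriv n f x))"
    using assms by (intro deriv_seqI has_vector_derivative_cnj smooth_has_vector_derivative)
  show "smooth (\<lambda>x. cnj (f x))" "nth_deriv n (\<lambda>x. cnj (f x)) = (\<lambda>x. cnj (nth_deriv n f x))"
    using deriv_seq_smooth[OF *] deriv_seq_nth_deriv[OF *, of n] by simp_all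
qed

lemma smooth_affine:
  assumes "smooth f"
  shows "smooth (\<lambda>x. f (a * x + b))"
    "nth_deriv n (\<lambda>x. f (a * x + b)) = (\<lambda>x. of_real a ^ n * nth_deriv n f (a * x + b))"
proof -
  let ?F = "\<lambda>n x. of_real a ^ n * nth_deriv n f (a * x + b)"
  have "((\<lambda>x. of_real a ^ n * nth_deriv n f (a * x + b)) has_vector_derivative
    of_real a ^ Suc n * nth_deriv (Suc n) f (a * x + b)) (at x)" for n x
  proof -
    have "((\<lambda>x. a * x + b) has_vector_derivative a) (at x)"
      by (auto intro!: derivative_eq_intros simp: has_real_derivative_iff_has_vector_derivative[symmetric])
    from vector_diff_chain_at[OF this smooth_has_vector_derivative[OF assms, of n "a * x + b"]]
    have "((\<lambda>x. nth_deriv n f (a * x + b)) has_vector_derivative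
      a *\<^sub>R nth_deriv (Suc n) f (a * x + b)) (at x)"
      by (simp add: o_def)
    from has_vector_derivative_mult_right[OF this, of "of_real a ^ n"]
    show ?thesis by (simp add: scaleR_conv_of_real algebra_simps)
  qed
  then have *: "deriv_seq ?F" by (rule deriv_seqI)
  show "smooth (\<lambda>x. f (a * x + b))"
    "nth_deriv n (\<lambda>x. f (a * x + b)) = (\<lambda>x. of_real a ^ n * nth_deriv n f (a * x + b))"
    using deriv_seq_smooth[OF *] deriv_seq_nth_deriv[OF *, of n] by simp_all
qed

lemma smooth_mult:
  assumes f: "smooth f" and g: "smooth g"
  shows "smooth (\<lambda>x. f x * g x)"
    "nth_deriv n (\<lambda>x. f x * g x) =
      (\<lambda>x. \<Sum>k\<le>n. of_nat (n choose k) * (nth_deriv k f x * nth_deriv (n - k) g x))"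
proof -
  let ?F = "\<lambda>n x. \<Sum>k\<le>n. of_nat (n choose k) * (nth_deriv k f x * nth_deriv (n - k) g x)"
  have "(?F n has_vector_derivative ?F (Suc n) x) (at x)" for n x
  proof -
    let ?a = "\<lambda>k. nth_deriv k f x" and ?b = "\<lambda>k. nth_deriv k g x"
    have "(?F n has_vector_derivative (\<Sum>k\<le>n. of_nat (n choose k) *
       (?a k * ?b (Suc (n - k)) + ?a (Suc k) * ?b (n - k)))) (at x)"
      by (intro has_vector_derivative_sum has_vector_derivative_mult_right
          has_vector_derivative_mult smooth_has_vector_derivative f g)
    moreover have "(\<Sum>k\<le>n. of_nat (n choose k) * (?a k * ?b (Suc (n - k)) + ?a (Suc k) * ?b (n - k)))
      = ?F (Suc n) x"
    proof -
      have "?F (Suc n) x = of_nat (Suc n choose 0) * (?a 0 * ?b (Suc n)) +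
          (\<Sum>k\<le>n. of_nat (Suc n choose Suc k) * (?a (Suc k) * ?b (n - k)))"
        by (subst sum.atMost_Suc_shift) simp
      also have "\<dots> = (?a 0 * ?b (Suc n) + (\<Sum>k\<le>n. of_nat (n choose Suc k) * (?a (Suc k) * ?b (n - k))))
          + (\<Sum>k\<le>n. of_nat (n choose k) * (?a (Suc k) * ?b (n - k)))"
        by (simp add: algebra_simps sum.distrib)
      also have "?a 0 * ?b (Suc n) + (\<Sum>k\<le>n. of_nat (n choose Suc k) * (?a (Suc k) * ?b (n - k)))
          = (\<Sum>k\<le>Suc n. of_nat (n choose k) * (?a k * ?b (Suc n - k)))"
        by (subst sum.atMost_Suc_shift) simp
      \<comment> \<open>The term \<open>k = Suc n\<close> drops out because
        \<open>n choose Suc n\<close> is 0.\<close>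
      also have "\<dots> = (\<Sum>k\<le>n. of_nat (n choose k) * (?a k * ?b (Suc (n - k))))"
        by (simp add: Suc_diff_le)
      finally show ?thesis by (simp add: algebra_simps sum.distrib)
    qed
    ultimately show ?thesis by simp
  qed
  then have *: "deriv_seq ?F" by (rule deriv_seqI)
  show "smooth (\<lambda>x. f x * g x)" "nth_deriv n (\<lambda>x. f x * g x) = ?F n"
    using deriv_seq_smooth[OF *] deriv_seq_nth_deriv[OF *, of n] by simp_all
qed

text \<open>A derivative at \<open>x\<close> sees only a neighbourhood of \<open>x\<close>, so
  agreement on an open set passes to the next derivative on the same set.\<close>

lemma nth_deriv_local:
  assumes "open V" "\<And>x. x \<in> V \<Longrightarrow> f x = g x" "x \<in> V"
  shows "nth_deriv n f x = nth_deriv n g x"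
  using assms(3)
proof (induction n arbitrary: x)
  case (Suc n)
  have "eventually (\<lambda>y. y \<in> V) (nhds x)"
    using assms(1) Suc.prems by (rule eventually_nhds_in_open)
  then have "\<forall>\<^sub>F y in nhds x. nth_deriv n f y = nth_deriv n g y"
    by eventually_elim (rule Suc.IH)
  then show ?case
    unfolding nth_deriv_Suc by (intro vector_derivative_cong_eq) auto
qed (use assms in auto)

lemma nth_deriv_zero [simp]: "nth_deriv n (\<lambda>x. 0) = (\<lambda>x. 0)"
  by (induction n) (auto simp: nth_deriv_Suc)

lemma smooth_const: "smooth (\<lambda>x. c)"
  using deriv_seq_smooth[of "\<lambda>n x. if n = 0 then c else 0"] by (auto simp: deriv_seq_def)

text \<open>An enclosing interval instead of the exact support: dilation, translation and
  correlation then act by interval arithmetic. The values at the two endpoints are left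
  free.\<close>

definition supp_in :: "real \<Rightarrow> real \<Rightarrow> (real \<Rightarrow> complex) \<Rightarrow> bool" where
  "supp_in a b f \<longleftrightarrow> (\<forall>x. x \<notin> {a..b} \<longrightarrow> f x = 0)"

lemma supp_in_mono: "supp_in a b f \<Longrightarrow> c \<le> a \<Longrightarrow> b \<le> d \<Longrightarrow> supp_in c d f"
  by (auto simp: supp_in_def)

lemma supp_in_nth_deriv:
  assumes "supp_in a b f"
  shows "supp_in a b (nth_deriv n f)"
proof -
  have "nth_deriv n f x = 0" if "x \<in> - {a..b}" for x
    using nth_deriv_local[of "- {a..b}" f "\<lambda>x. 0" x n] assms that
    by (auto simp: supp_in_def)
  then show ?thesis by (auto simp: supp_in_def)
qed

lemma supp_in_fun_support: "supp_in a b f \<longleftrightarrow> fun_support f \<subseteq> {a..b}"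
proof -
  have "{x. f x \<noteq> 0} \<subseteq> {a..b} \<longleftrightarrow> fun_support f \<subseteq> {a..b}"
    unfolding fun_support_def
    by (meson closed_atLeastAtMost closure_minimal closure_subset order_trans)
  then show ?thesis by (auto simp: supp_in_def)
qed

lemma test_functionI:
  assumes "smooth f" "supp_in a b f"
  shows "f \<in> test_functions"
proof -
  have "compact ({a..b} \<inter> fun_support f)"
    by (intro compact_Int_closed compact_Icc) (simp add: fun_support_def)
  with assms show ?thesis
    by (simp add: test_functions_def supp_in_fun_support Int_absorb1)
qed

lemma test_function_smooth: "f \<in> test_functions \<Longrightarrow> smooth f"
  by (simp add: test_functions_def)

lemma test_function_supp:
  assumes "f \<in> test_functions"
  obtains r where "r > 0" "supp_in (-r) r f"
proof -
  have "bounded (fun_support f)"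
    using assms by (simp add: test_functions_def compact_imp_bounded)
  then obtain r where "r > 0" "fun_support f \<subseteq> cball 0 r"
    by (metis bounded_subset_ballD ball_subset_cball subset_trans)
  then show thesis
    using that[of r] by (simp add: supp_in_fun_support cball_eq_atLeastAtMost)
qed

text \<open>A bound on the \<open>C^M\<close> norm as a predicate, so that estimates do not handle
  suprema.\<close>

definition deriv_bound :: "nat \<Rightarrow> real \<Rightarrow> (real \<Rightarrow> complex) \<Rightarrow> bool" where
  "deriv_bound M B f \<longleftrightarrow> (\<forall>k\<le>M. \<forall>x. cmod (nth_deriv k f x) \<le> B)"

lemma deriv_boundD: "deriv_bound M B f \<Longrightarrow> k \<le> M \<Longrightarrow> cmod (nth_deriv k f x) \<le> B"
  by (simp add: deriv_bound_def)

lemma deriv_bound_0D: "deriv_bound M B f \<Longrightarrow> cmod (f x) \<le> B"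
  using deriv_boundD[of M B f 0] by simp

lemma deriv_bound_mono: "deriv_bound M B f \<Longrightarrow> N \<le> M \<Longrightarrow> B \<le> C \<Longrightarrow> deriv_bound N C f"
  unfolding deriv_bound_def by (meson order_trans)

lemma deriv_bound_exists:
  assumes "\<And>k. bounded (range (nth_deriv k f))"
  obtains B where "B > 0" "deriv_bound M B f"
proof -
  have "\<exists>B>0. deriv_bound M B f"
  proof (induction M)
    case 0
    obtain B where "B > 0" "\<forall>y\<in>range f. norm y \<le> B"
      using assms[of 0] unfolding bounded_pos by auto
    then show ?case by (auto simp: deriv_bound_def)
  next
    case (Suc M)
    then obtain B where B: "B > 0" "deriv_bound M B f" by blast
    obtain B' where B': "B' > 0" "\<And>x. norm (nth_deriv (Suc M) f x) \<le> B'"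
      using assms[of "Suc M"] unfolding bounded_pos by auto
    have "deriv_bound (Suc M) (max B B') f"
      using B(2) B'(2) by (auto simp: deriv_bound_def le_Suc_eq le_max_iff_disj)
    then show ?case using B(1) by (intro exI[of _ "max B B'"]) auto
  qed
  then show thesis using that by blast
qed

lemma continuous_supp_bounded:
  assumes "continuous_on UNIV f" "supp_in a b f"
  shows "bounded (range f)"
proof -
  have "compact (f ` {a..b})"
    using assms(1) by (intro compact_continuous_image) (auto intro: continuous_on_subset)
  then have b: "bounded (insert 0 (f ` {a..b}))"
    by (simp add: compact_imp_bounded)
  have "range f \<subseteq> insert 0 (f ` {a..b})"
    using assms(2) unfolding supp_in_def by blast
  then show ?thesis
    by (rule bounded_subset[OF b])
qed

lemma test_function_deriv_bound:
  assumes "f \<in> test_functions"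
  obtains B where "B > 0" "deriv_bound M B f"
proof -
  obtain r where "supp_in (-r) r f" using test_function_supp[OF assms] by blast
  then have "bounded (range (nth_deriv k f))" for k
    using smooth_continuous[OF test_function_smooth[OF assms]]
    by (intro continuous_supp_bounded supp_in_nth_deriv)
  from deriv_bound_exists[OF this] show thesis using that .
qed

section \<open>Closure of the test functions under algebraic operations and derivatives\<close>

lemma test_add:
  assumes "f \<in> test_functions" "g \<in> test_functions"
  shows "(\<lambda>x. f x + g x) \<in> test_functions"
proof -
  obtain r where "supp_in (-r) r f" by (rule test_function_supp[OF assms(1)])
  then have "supp_in (- max r s) (max r s) f" for s by (rule supp_in_mono) auto
  moreover obtain s where "supp_in (-s) s g" by (rule test_function_supp[OF assms(2)])
  then have "supp_in (- max r s) (max r s) g" for r by (rule supp_in_mono) auto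
  ultimately have "supp_in (- max r s) (max r s) (\<lambda>x. f x + g x)"
    by (simp add: supp_in_def)
  from test_functionI[OF _ this] show ?thesis
    using assms by (simp add: smooth_add test_function_smooth)
qed

lemma test_cmult:
  assumes "f \<in> test_functions"
  shows "(\<lambda>x. c * f x) \<in> test_functions"
proof -
  obtain r where "supp_in (-r) r f" by (rule test_function_supp[OF assms])
  then have "supp_in (-r) r (\<lambda>x. c * f x)" by (simp add: supp_in_def)
  from test_functionI[OF _ this] show ?thesis
    using assms by (simp add: smooth_cmult test_function_smooth)
qed

lemma test_diff:
  assumes "f \<in> test_functions" "g \<in> test_functions"
  shows "(\<lambda>x. f x - g x) \<in> test_functions"
  using test_add[OF assms(1) test_cmult[OF assms(2), of "-1"]] by simp

lemma test_cnj:
  assumes "f \<in> test_functions"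
  shows "(\<lambda>x. cnj (f x)) \<in> test_functions"
proof -
  obtain r where "supp_in (-r) r f" by (rule test_function_supp[OF assms])
  then have "supp_in (-r) r (\<lambda>x. cnj (f x))" by (simp add: supp_in_def)
  from test_functionI[OF _ this] show ?thesis
    using assms by (simp add: smooth_cnj test_function_smooth)
qed

lemma test_nth_deriv:
  assumes "f \<in> test_functions"
  shows "nth_deriv n f \<in> test_functions"
proof -
  obtain r where "supp_in (-r) r f" by (rule test_function_supp[OF assms])
  from test_functionI[OF _ supp_in_nth_deriv[OF this]] show ?thesis
    using assms by (simp add: smooth_nth_deriv test_function_smooth)
qed

lemma deriv_bound_cmult:
  "smooth f \<Longrightarrow> deriv_bound M B f \<Longrightarrow> deriv_bound M (cmod c * B) (\<lambda>x. c * f x)"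
  by (simp add: deriv_bound_def smooth_cmult norm_mult mult_left_mono)

lemma deriv_bound_add:
  "smooth f \<Longrightarrow> smooth g \<Longrightarrow> deriv_bound M B f \<Longrightarrow> deriv_bound M C g \<Longrightarrow>
    deriv_bound M (B + C) (\<lambda>x. f x + g x)"
  by (simp add: deriv_bound_def smooth_add) (meson norm_triangle_mono)

lemma deriv_bound_cnj: "smooth f \<Longrightarrow> deriv_bound M B f \<Longrightarrow> deriv_bound M B (\<lambda>x. cnj (f x))"
  by (simp add: deriv_bound_def smooth_cnj)

section \<open>Integrals and correlations\<close>

lemma lebesgue_integral_supp_in:
  assumes "continuous_on UNIV f" "supp_in a b f"
  shows "integrable lebesgue f" "(LINT x|lebesgue. f x) = integral {a..b} f"
proof -
  have i: "set_integrable lebesgue {a..b} f"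
    using assms(1) by (intro absolutely_integrable_continuous_real) (auto intro: continuous_on_subset)
  have e: "(\<lambda>x. indicat_real {a..b} x *\<^sub>R f x) = f"
    using assms(2) by (auto simp: supp_in_def indicator_def fun_eq_iff)
  show "integrable lebesgue f"
    using i unfolding set_integrable_def e .
  show "(LINT x|lebesgue. f x) = integral {a..b} f"
    using set_lebesgue_integral_eq_integral(2)[OF i] unfolding set_lebesgue_integral_def e .
qed

text \<open>In \<open>Y(x) \<otimes> f(y)\<close> applied to \<open>g (x + y)\<close>, this is the
  inner integral over \<open>y\<close>; hence \<open>Y (corr f g)\<close> is the pairing of
  \<open>Y * f\<close> with \<open>g\<close>, and a correlation appears instead of a
  convolution.\<close>

definition corr :: "(real \<Rightarrow> complex) \<Rightarrow> (real \<Rightarrow> complex) \<Rightarrow> real \<Rightarrow> complex" where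
  "corr f g x = (LINT y|lebesgue. f y * g (x + y))"

lemma corr_integrand:
  assumes "continuous_on UNIV f" "supp_in a b f" "continuous_on UNIV g"
  shows "continuous_on UNIV (\<lambda>y. f y * g (x + y))" "supp_in a b (\<lambda>y. f y * g (x + y))"
proof -
  show "continuous_on UNIV (\<lambda>y. f y * g (x + y))"
    by (intro continuous_intros assms continuous_on_compose2[OF assms(3)]) auto
  show "supp_in a b (\<lambda>y. f y * g (x + y))"
    using assms(2) by (auto simp: supp_in_def)
qed

lemma corr_eq_integral:
  assumes "continuous_on UNIV f" "supp_in a b f" "continuous_on UNIV g"
  shows "corr f g x = integral {a..b} (\<lambda>y. f y * g (x + y))"
  unfolding corr_def by (rule lebesgue_integral_supp_in(2)[OF corr_integrand[OF assms]])

lemma corr_integrable: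
  assumes "continuous_on UNIV f" "supp_in a b f" "continuous_on UNIV g"
  shows "integrable lebesgue (\<lambda>y. f y * g (x + y))"
  by (rule lebesgue_integral_supp_in(1)[OF corr_integrand[OF assms]])

lemma test_corr_integrable:
  assumes "f \<in> test_functions" "smooth g"
  shows "integrable lebesgue (\<lambda>y. f y * g (x + y))"
proof -
  obtain r where "supp_in (-r) r f" by (rule test_function_supp[OF assms(1)])
  from corr_integrable[OF _ this] show ?thesis
    using assms by (simp add: smooth_continuous_0 test_function_smooth)
qed

lemma corr_add_left:
  assumes "f \<in> test_functions" "g \<in> test_functions" "smooth h"
  shows "corr (\<lambda>x. f x + g x) h = (\<lambda>x. corr f h x + corr g h x)"
  using assms by (simp add: corr_def fun_eq_iff distrib_right test_corr_integrable)

lemma corr_diff_left: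
  assumes "f \<in> test_functions" "g \<in> test_functions" "smooth h"
  shows "corr (\<lambda>x. f x - g x) h = (\<lambda>x. corr f h x - corr g h x)"
  using assms by (simp add: corr_def fun_eq_iff left_diff_distrib test_corr_integrable)

lemma corr_cmult_left: "corr (\<lambda>x. c * f x) h = (\<lambda>x. c * corr f h x)"
  by (simp add: corr_def fun_eq_iff mult.assoc)

lemma corr_add_right:
  assumes "f \<in> test_functions" "smooth g" "smooth h"
  shows "corr f (\<lambda>x. g x + h x) = (\<lambda>x. corr f g x + corr f h x)"
  using assms by (simp add: corr_def fun_eq_iff distrib_left test_corr_integrable)

lemma corr_diff_right:
  assumes "f \<in> test_functions" "smooth g" "smooth h"
  shows "corr f (\<lambda>x. g x - h x) = (\<lambda>x. corr f g x - corr f h x)"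
  using assms by (simp add: corr_def fun_eq_iff right_diff_distrib test_corr_integrable)

lemma corr_cmult_right: "corr f (\<lambda>x. c * h x) = (\<lambda>x. c * corr f h x)"
  by (simp add: corr_def fun_eq_iff mult.left_commute)

text \<open>Subtract \<open>y \<in> {a..b}\<close> from \<open>x + y \<in> {c..d}\<close>. Moving
  \<open>f\<close> to the right moves the correlation to the left, which is how causality will be
  brought in.\<close>

lemma corr_supp:
  assumes "supp_in a b f" "supp_in c d g"
  shows "supp_in (c - b) (d - a) (corr f g)"
  unfolding supp_in_def
proof (intro allI impI)
  fix x assume x: "x \<notin> {c - b..d - a}"
  have "f y * g (x + y) = 0" for y
  proof (cases "y \<in> {a..b}")
    case True
    then have "x + y \<notin> {c..d}" using x by auto
    then show ?thesis using assms(2) by (simp add: supp_in_def)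
  qed (use assms(1) in \<open>auto simp: supp_in_def\<close>)
  then have "(\<lambda>y. f y * g (x + y)) = (\<lambda>y. 0)" by blast
  then show "corr f g x = 0" unfolding corr_def by simp
qed

text \<open>Differentiation under an integral over a fixed interval; all derivatives fall on
  \<open>g\<close>, so continuity of \<open>f\<close> is enough.\<close>

lemma corr_smooth:
  assumes f: "continuous_on UNIV f" "supp_in a b f" and g: "smooth g"
  shows "smooth (corr f g)" "nth_deriv n (corr f g) = corr f (nth_deriv n g)"
proof -
  have e: "corr f (nth_deriv n g) = (\<lambda>x. integral (cbox a b) (\<lambda>y. f y * nth_deriv n g (x + y)))" for n
    using corr_eq_integral[OF f smooth_continuous[OF g]] by (simp add: fun_eq_iff)
  have "(corr f (nth_deriv n g) has_vector_derivative corr f (nth_deriv (Suc n) g) x) (at x)" for n x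
  proof -
    have "(corr f (nth_deriv n g) has_vector_derivative corr f (nth_deriv (Suc n) g) x) (at x within UNIV)"
      unfolding e
    proof (rule leibniz_rule_vector_derivative)
      fix x y :: real
      have "((\<lambda>x. x + y) has_vector_derivative 1) (at x)"
        by (auto intro!: derivative_eq_intros simp: has_real_derivative_iff_has_vector_derivative[symmetric])
      from vector_diff_chain_at[OF this smooth_has_vector_derivative[OF g, of n "x + y"]]
      show "((\<lambda>x. f y * nth_deriv n g (x + y)) has_vector_derivative f y * nth_deriv (Suc n) g (x + y)) (at x within UNIV)"
        by (intro has_vector_derivative_mult_right) (simp add: o_def)
    next
      fix x
      show "(\<lambda>y. f y * nth_deriv n g (x + y)) integrable_on cbox a b"
        unfolding cbox_interval by (intro integrable_continuous_real continuous_on_subset[OF corr_integrand(1)[OF f]]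
            smooth_continuous g) auto
    next
      show "continuous_on (UNIV \<times> cbox a b) (\<lambda>(x, y). f y * nth_deriv (Suc n) g (x + y))"
        unfolding split_beta
        by (intro continuous_intros continuous_on_compose2[OF f(1)]
            continuous_on_compose2[OF smooth_continuous[OF g, of UNIV]]) auto
    qed auto
    then show ?thesis by simp
  qed
  then have *: "deriv_seq (\<lambda>n. corr f (nth_deriv n g))"
    by (rule deriv_seqI)
  show "smooth (corr f g)" "nth_deriv n (corr f g) = corr f (nth_deriv n g)"
    using deriv_seq_smooth[OF *] deriv_seq_nth_deriv[OF *, of n] by simp_all
qed

lemma test_corr_smooth:
  assumes "f \<in> test_functions" "smooth g"
  shows "smooth (corr f g)" "nth_deriv n (corr f g) = corr f (nth_deriv n g)"
proof -
  obtain r where "supp_in (-r) r f" by (rule test_function_supp[OF assms(1)])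
  from corr_smooth[OF _ this assms(2)]
  show "smooth (corr f g)" "nth_deriv n (corr f g) = corr f (nth_deriv n g)"
    using assms by (simp_all add: smooth_continuous_0 test_function_smooth)
qed

lemma test_corr:
  assumes "f \<in> test_functions" "g \<in> test_functions"
  shows "corr f g \<in> test_functions"
proof -
  obtain r where r: "supp_in (-r) r f" by (rule test_function_supp[OF assms(1)])
  obtain s where s: "supp_in (-s) s g" by (rule test_function_supp[OF assms(2)])
  from test_functionI[OF _ corr_supp[OF r s]] show ?thesis
    using assms by (simp add: test_corr_smooth test_function_smooth)
qed

lemma corr_bound:
  assumes f: "continuous_on UNIV f" "supp_in a b f" and g: "continuous_on UNIV g"
    and "a \<le> b" and F: "\<And>x. cmod (f x) \<le> F" and G: "\<And>x. cmod (g x) \<le> G"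
  shows "cmod (corr f g x) \<le> F * G * (b - a)"
  unfolding corr_eq_integral[OF f g]
proof (rule integral_bound)
  show "continuous_on {a..b} (\<lambda>y. f y * g (x + y))"
    by (rule continuous_on_subset[OF corr_integrand(1)[OF f g]]) auto
  show "cmod (f y * g (x + y)) \<le> F * G" for y
    unfolding norm_mult using F[of y] G[of "x + y"] order_trans[OF norm_ge_zero F]
    by (intro mult_mono) auto
qed fact

text \<open>Integration by parts, the boundary terms being zero.\<close>

lemma corr_deriv:
  assumes f: "f \<in> test_functions" and g: "smooth g"
  shows "corr (nth_deriv 1 f) g x = - corr f (nth_deriv 1 g) x"
proof -
  note sf = test_function_smooth[OF f]
  obtain r where r: "r > 0" "supp_in (-r) r f" using test_function_supp[OF f] .
  \<comment> \<open>The extra unit makes \<open>f\<close> vanish at both ends;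
    \<open>supp_in (-r) r f\<close> leaves the values at \<open>-r\<close> and \<open>r\<close>
    open.\<close>
  define s where "s = r + 1"
  have s: "supp_in (-s) s f" "-s \<le> s" "f s = 0" "f (-s) = 0"
    using r by (auto simp: s_def supp_in_def)
  have s1: "supp_in (-s) s (nth_deriv 1 f)" using s(1) by (rule supp_in_nth_deriv)
  have "((\<lambda>y. f y * nth_deriv 1 g (x + y) + nth_deriv 1 f y * g (x + y)) has_integral
      f s * g (x + s) - f (-s) * g (x + (-s))) {-s..s}"
  proof (rule fundamental_theorem_of_calculus[OF s(2)])
    fix y
    have "((\<lambda>y. x + y) has_vector_derivative 1) (at y)"
      by (auto intro!: derivative_eq_intros simp: has_real_derivative_iff_has_vector_derivative[symmetric])
    from vector_diff_chain_at[OF this, of g] smooth_has_vector_derivative[OF g, of 0]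
    have "((\<lambda>y. g (x + y)) has_vector_derivative nth_deriv 1 g (x + y)) (at y)"
      by (simp add: o_def)
    then have "((\<lambda>y. f y * g (x + y)) has_vector_derivative
        f y * nth_deriv 1 g (x + y) + nth_deriv 1 f y * g (x + y)) (at y)"
      using smooth_has_vector_derivative[OF sf, of 0 y] by (intro has_vector_derivative_mult) simp_all
    then show "((\<lambda>y. f y * g (x + y)) has_vector_derivative
        f y * nth_deriv 1 g (x + y) + nth_deriv 1 f y * g (x + y)) (at y within {-s..s})"
      by (rule has_vector_derivative_at_within)
  qed
  then have "integral {-s..s} (\<lambda>y. f y * nth_deriv 1 g (x + y) + nth_deriv 1 f y * g (x + y)) = 0"
    using s by (simp add: integral_unique)
  moreover have "(\<lambda>y. f y * nth_deriv 1 g (x + y)) integrable_on {-s..s}"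
    by (intro integrable_continuous_real continuous_on_subset[OF corr_integrand(1)[OF _ s(1)]]
          smooth_continuous smooth_continuous_0 sf g) auto
  moreover have "(\<lambda>y. nth_deriv 1 f y * g (x + y)) integrable_on {-s..s}"
    by (intro integrable_continuous_real continuous_on_subset[OF corr_integrand(1)[OF _ s1]]
          smooth_continuous smooth_continuous_0 sf g) auto
  ultimately have "integral {-s..s} (\<lambda>y. f y * nth_deriv 1 g (x + y)) +
      integral {-s..s} (\<lambda>y. nth_deriv 1 f y * g (x + y)) = 0"
    by (simp add: Henstock_Kurzweil_Integration.integral_add)
  moreover have "corr (nth_deriv 1 f) g x = integral {-s..s} (\<lambda>y. nth_deriv 1 f y * g (x + y))"
    by (intro corr_eq_integral smooth_continuous smooth_continuous_0 sf g s1)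
  moreover have "corr f (nth_deriv 1 g) x = integral {-s..s} (\<lambda>y. f y * nth_deriv 1 g (x + y))"
    by (intro corr_eq_integral smooth_continuous smooth_continuous_0 sf g s(1))
  ultimately show ?thesis by (simp add: add_eq_0_iff)
qed

lemma corr_nth_deriv:
  assumes f: "f \<in> test_functions" and g: "smooth g"
  shows "corr (nth_deriv n f) g = (\<lambda>x. (-1) ^ n * corr f (nth_deriv n g) x)"
  using g
proof (induction n arbitrary: g)
  case (Suc n)
  have "corr (nth_deriv (Suc n) f) g x = (-1) ^ Suc n * corr f (nth_deriv (Suc n) g) x" for x
  proof -
    have "corr (nth_deriv 1 (nth_deriv n f)) g x = - corr (nth_deriv n f) (nth_deriv 1 g) x"
      by (rule corr_deriv[OF test_nth_deriv[OF f] Suc.prems])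
    then show ?thesis
      using Suc.IH[OF smooth_nth_deriv(1)[OF Suc.prems, of 1]]
      by (simp add: smooth_nth_deriv(2)[OF Suc.prems] smooth_nth_deriv(2)[OF test_function_smooth[OF f]])
  qed
  then show ?case by blast
qed simp

section \<open>Dyadic dilations preserving the integral\<close>

definition dil :: "nat \<Rightarrow> (real \<Rightarrow> complex) \<Rightarrow> real \<Rightarrow> complex" where
  "dil j f x = 2 ^ j * f (2 ^ j * x)"

lemma dil_smooth:
  assumes "smooth f"
  shows "smooth (dil j f)" "nth_deriv n (dil j f) = (\<lambda>x. 2 ^ (j * Suc n) * nth_deriv n f (2 ^ j * x))"
proof -
  have d: "dil j f = (\<lambda>x. 2 ^ j * f (2 ^ j * x + 0))" by (simp add: dil_def fun_eq_iff)
  have e: "(2::complex) ^ (j * Suc n) = 2 ^ j * (2 ^ j) ^ n" by (simp add: power_mult power_add)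
  show "smooth (dil j f)" "nth_deriv n (dil j f) = (\<lambda>x. 2 ^ (j * Suc n) * nth_deriv n f (2 ^ j * x))"
    unfolding d e smooth_cmult[OF smooth_affine(1)[OF assms]] smooth_affine(2)[OF assms]
    using smooth_cmult(1)[OF smooth_affine(1)[OF assms, of "2 ^ j" 0]] by (simp_all add: mult.assoc)
qed

lemma dil_supp:
  assumes "supp_in a b f"
  shows "supp_in (a / 2 ^ j) (b / 2 ^ j) (dil j f)"
  using assms by (auto simp: supp_in_def dil_def field_simps)

lemma dil_supp_0:
  assumes "supp_in 0 b f" "0 \<le> b"
  shows "supp_in 0 b (dil j f)"
proof -
  have "b / 2 ^ j \<le> b / 1" using assms(2) by (intro divide_left_mono) auto
  then show ?thesis using dil_supp[OF assms(1), of j] by (auto intro: supp_in_mono)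
qed

lemma dil_test:
  assumes "f \<in> test_functions"
  shows "dil j f \<in> test_functions"
proof -
  obtain r where "supp_in (-r) r f" by (rule test_function_supp[OF assms])
  from test_functionI[OF _ dil_supp[OF this]] show ?thesis
    using assms by (simp add: dil_smooth test_function_smooth)
qed

lemma dil_deriv_bound:
  assumes "smooth f" "deriv_bound M B f" "0 \<le> B"
  shows "deriv_bound M (2 ^ (j * Suc M) * B) (dil j f)"
  unfolding deriv_bound_def
proof (intro allI impI)
  fix k x assume k: "k \<le> M"
  have "(2::real) ^ (j * Suc k) \<le> 2 ^ (j * Suc M)"
    using k by (intro power_increasing) auto
  then show "cmod (nth_deriv k (dil j f) x) \<le> 2 ^ (j * Suc M) * B"
    unfolding dil_smooth(2)[OF assms(1)] norm_mult norm_power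
    using deriv_boundD[OF assms(2) k, of "2 ^ j * x"] assms(3)
    by (intro mult_mono) auto
qed

text \<open>The height of the kernel grows like \<open>2 ^ j\<close> while its support shrinks like
  \<open>2 ^ -j\<close>; the normalization of \<open>dil\<close> makes them cancel, so the bound is
  uniform in \<open>j\<close>.\<close>

lemma dil_corr_bound:
  assumes f: "smooth f" "supp_in 0 2 f" and g: "continuous_on UNIV g"
    and F: "\<And>x. cmod (f x) \<le> F" and G: "\<And>x. cmod (g x) \<le> G"
  shows "cmod (corr (dil j f) g x) \<le> 2 * F * G"
proof -
  have "cmod (corr (dil j f) g x) \<le> (2 ^ j * F) * G * (2 / 2 ^ j - 0)"
    using dil_supp[OF f(2), of j] F G
    by (intro corr_bound smooth_continuous_0 dil_smooth f(1) g) (auto simp: dil_def norm_mult norm_power)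
  then show ?thesis by (simp add: field_simps)
qed

text \<open>As the kernel has integral one, the error is the integral of
  \<open>dil j f y * (g (x + y) - g x)\<close>, and the mean value inequality controls the increment
  of \<open>g\<close>.\<close>

lemma dil_corr_approx:
  assumes f: "smooth f" "supp_in 0 2 f" and f1: "integral {0..2} f = 1" and g: "smooth g"
    and F: "\<And>x. cmod (f x) \<le> F" and G: "\<And>x. cmod (nth_deriv 1 g x) \<le> G"
  shows "cmod (corr (dil j f) g x - g x) \<le> 4 * F * G / 2 ^ j"
proof -
  let ?b = "2 / 2 ^ j :: real"
  note sd = dil_smooth(1)[OF f(1), of j]
  have supp: "supp_in 0 ?b (dil j f)" using dil_supp[OF f(2), of j] by simp
  have "(f has_integral 1) (cbox 0 2)"
    using f1 integrable_integral[OF integrable_continuous_real[OF smooth_continuous_0[OF f(1)], of 0 2]]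
    by simp
  from has_integral_affinity'[OF this, of "2 ^ j" 0]
  have "((\<lambda>x. f (2 ^ j * x)) has_integral 1 / 2 ^ j) {0..?b}"
    by (simp add: scaleR_conv_of_real divide_inverse mult.commute)
  then have "((\<lambda>x. 2 ^ j * f (2 ^ j * x)) has_integral 2 ^ j * (1 / 2 ^ j)) {0..?b}"
    by (rule has_integral_mult_right)
  then have "(dil j f has_integral 1) {0..?b}"
    by (simp add: dil_def[abs_def])
  from has_integral_mult_left[OF this, of "g x"]
  have 1: "((\<lambda>y. dil j f y * g x) has_integral g x) {0..?b}" by simp
  have "((\<lambda>y. dil j f y * g (x + y)) has_integral corr (dil j f) g x) {0..?b}"
    unfolding corr_eq_integral[OF smooth_continuous_0[OF sd] supp smooth_continuous_0[OF g]]
    by (intro integrable_integral integrable_continuous_real continuous_on_subset[OF corr_integrand(1)[OF _ supp]]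
          smooth_continuous_0 sd g) auto
  from has_integral_diff[OF this 1]
  have "((\<lambda>y. dil j f y * g (x + y) - dil j f y * g x) has_integral corr (dil j f) g x - g x) (cbox 0 ?b)"
    by simp
  moreover have "cmod (dil j f y * g (x + y) - dil j f y * g x) \<le> (2 ^ j * F) * (G * ?b)"
    if "y \<in> cbox 0 ?b" for y
  proof -
    have "norm (g (x + y) - g x) \<le> G * norm ((x + y) - x)"
    proof (rule differentiable_bound[of UNIV])
      show "(g has_derivative (\<lambda>h. h *\<^sub>R nth_deriv 1 g z)) (at z within UNIV)" for z
        using smooth_has_vector_derivative[OF g, of 0 z] by (simp add: has_vector_derivative_def)
      show "onorm (\<lambda>h. h *\<^sub>R nth_deriv 1 g z) \<le> G" for z
      proof (rule onorm_bound)
        show "0 \<le> G" using order_trans[OF norm_ge_zero G] .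
        show "norm (h *\<^sub>R nth_deriv 1 g z) \<le> G * norm h" for h
          using mult_right_mono[OF G, of "\<bar>h\<bar>" z] by (simp add: mult.commute)
      qed
    qed auto
    also have "\<dots> \<le> G * ?b" using that order_trans[OF norm_ge_zero G] by (intro mult_left_mono) auto
    finally have "norm (g (x + y) - g x) \<le> G * ?b" .
    moreover have "cmod (dil j f y) \<le> 2 ^ j * F" using F by (simp add: dil_def norm_mult norm_power)
    ultimately show ?thesis
      unfolding right_diff_distrib[symmetric] norm_mult
      using order_trans[OF norm_ge_zero F] by (intro mult_mono) auto
  qed
  moreover have "0 \<le> (2 ^ j * F) * (G * ?b)"
    using order_trans[OF norm_ge_zero F] order_trans[OF norm_ge_zero G] by simp
  \<comment> \<open>Kernel \<open>2 ^ j * F\<close>, increment \<open>G * ?b\<close> and length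
    \<open>?b\<close> multiply to \<open>4 * F * G / 2 ^ j\<close>, as \<open>?b\<close> is
    \<open>2 / 2 ^ j\<close>.\<close>
  ultimately have "cmod (corr (dil j f) g x - g x) \<le> (2 ^ j * F) * (G * ?b) * measure lborel (cbox 0 ?b)"
    by (intro has_integral_bound) auto
  then show ?thesis by (simp add: field_simps)
qed

subsection \<open>Mollifiers with vanishing moments\<close>

lemma tendsto_poly_exp: "((\<lambda>t. poly p t * exp (- t)) \<longlongrightarrow> (0::real)) at_top"
proof -
  have "((\<lambda>t. \<Sum>i\<le>degree p. coeff p i * (t ^ i / exp t)) \<longlongrightarrow> (\<Sum>i\<le>degree p. coeff p i * 0)) at_top"
    by (intro tendsto_intros tendsto_power_div_exp_0)
  then show ?thesis
    by (simp add: poly_altdef sum_distrib_right exp_minus divide_inverse mult.assoc)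
qed

text \<open>The polynomial in \<open>1 / x\<close> is carried along because
  \<open>exp (- 1 / x)\<close> alone is not closed under differentiation, whereas this family
  is.\<close>

definition flat :: "real poly \<Rightarrow> real \<Rightarrow> real" where
  "flat p x = (if x > 0 then poly p (inverse x) * exp (- inverse x) else 0)"

text \<open>With \<open>t = 1 / x\<close>, differentiation in \<open>x\<close> is
  \<open>- t^2 d/dt\<close>, and \<open>d/dt\<close> turns the factor \<open>p\<close> of
  \<open>exp (- t)\<close> into \<open>pderiv p - p\<close>.\<close>

definition flat_deriv :: "real poly \<Rightarrow> real poly" where
  "flat_deriv p = [:0, 0, 1:] * (p - pderiv p)"

lemma has_real_derivative_flat: "(flat p has_real_derivative flat (flat_deriv p) x) (at x)"
proof (cases x "0::real" rule: linorder_cases)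
  case less
  have "((\<lambda>x. 0) has_real_derivative flat (flat_deriv p) x) (at x)"
    using less by (auto simp: flat_def)
  then show ?thesis
    by (rule has_field_derivative_transform_within_open[of _ _ _ "{..<0}"])
      (use less in \<open>auto simp: flat_def\<close>)
next
  case greater
  have "((\<lambda>x. poly p (inverse x) * exp (- inverse x)) has_real_derivative flat (flat_deriv p) x) (at x)"
    using greater
    by (auto intro!: derivative_eq_intros DERIV_chain'[of inverse _ _ _ "poly p"]
        simp: flat_def flat_deriv_def algebra_simps power2_eq_square)
  then show ?thesis
    by (rule has_field_derivative_transform_within_open[of _ _ _ "{0<..}"])
      (use greater in \<open>auto simp: flat_def\<close>)
next
  case equal
  have "((\<lambda>h. (flat p (0 + h) - flat p 0) / h) \<longlongrightarrow> 0) (at 0)"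
    unfolding filterlim_at_split
  proof
    have "\<forall>\<^sub>F h in at_left 0. 0 = (flat p (0 + h) - flat p 0) / h"
      by (auto simp: eventually_at_filter flat_def)
    then show "((\<lambda>h. (flat p (0 + h) - flat p 0) / h) \<longlongrightarrow> 0) (at_left 0)"
      by (rule Lim_transform_eventually[OF tendsto_const])
  next
    \<comment> \<open>From the right, the difference quotient at 0 has again the flat form: dividing
      by \<open>h\<close> multiplies \<open>p\<close> by its variable.\<close>
    have "((\<lambda>h. poly (pCons 0 p) (inverse h) * exp (- inverse h)) \<longlongrightarrow> (0::real)) (at_right 0)"
      by (rule filterlim_compose[OF tendsto_poly_exp filterlim_inverse_at_top_right])
    moreover have "\<forall>\<^sub>F h in at_right 0. poly (pCons 0 p) (inverse h) * exp (- inverse h) =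
        (flat p (0 + h) - flat p 0) / h"
      by (auto simp: eventually_at_filter flat_def divide_inverse)
    ultimately show "((\<lambda>h. (flat p (0 + h) - flat p 0) / h) \<longlongrightarrow> 0) (at_right 0)"
      by (rule Lim_transform_eventually)
  qed
  then show ?thesis
    unfolding DERIV_def equal by (simp add: flat_def)
qed

lemma smooth_flat: "smooth (\<lambda>x. of_real (flat p x))"
proof -
  have *: "deriv_seq (\<lambda>n x. of_real (flat ((flat_deriv ^^ n) p) x))"
  proof (rule deriv_seqI)
    fix n x
    show "((\<lambda>x. complex_of_real (flat ((flat_deriv ^^ n) p) x)) has_vector_derivative
        of_real (flat ((flat_deriv ^^ Suc n) p) x)) (at x)"
      using has_vector_derivative_of_real[OF has_real_derivative_flat[of "(flat_deriv ^^ n) p" x]] by simp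
  qed
  show ?thesis using deriv_seq_smooth[OF *] by simp
qed

lemma bump_exists:
  assumes "a < b"
  obtains f where "f \<in> test_functions" "supp_in a b f" "integral {a..b} f = 1"
proof -
  define g where "g x = flat 1 (x - a) * flat 1 (b - x)" for x
  define f where "f x = complex_of_real (g x)" for x
  have f_eq: "f = (\<lambda>x. of_real (flat 1 (1 * x + - a)) * of_real (flat 1 ((-1) * x + b)))"
    by (simp add: f_def g_def fun_eq_iff algebra_simps)
  have smooth: "smooth f"
    unfolding f_eq by (intro smooth_mult smooth_affine[where f = "\<lambda>x. of_real (flat 1 x)"] smooth_flat)
  have supp: "supp_in a b f" by (auto simp: supp_in_def f_def g_def flat_def)
  have "continuous_on {a..b} (\<lambda>x. Re (f x))"
    by (intro continuous_intros smooth_continuous_0 smooth)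
  then have cont: "continuous_on {a..b} g" by (simp add: f_def)
  have nonneg: "g x \<ge> 0" for x by (simp add: g_def flat_def)
  have "integral {a..b} g \<noteq> 0"
  proof
    assume "integral {a..b} g = 0"
    then have "(g has_integral 0) (cbox a b)"
      using integrable_integral[OF integrable_continuous_real[OF cont]] by simp
    then have "g ((a + b) / 2) = 0"
      using has_integral_0_cbox_imp_0[of a b g "(a + b) / 2"] cont nonneg assms by (auto simp: box_real)
    moreover have "g ((a + b) / 2) > 0"
      using assms by (simp add: g_def flat_def field_simps)
    ultimately show False by simp
  qed
  moreover have "integral {a..b} f = of_real (integral {a..b} g)"
    unfolding f_def[abs_def] using integral_linear[OF integrable_continuous_real[OF cont] bounded_linear_of_real]
    by (simp add: o_def)
  ultimately have "integral {a..b} (\<lambda>x. inverse (integral {a..b} f) * f x) = 1"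
    by simp
  moreover have "supp_in a b (\<lambda>x. inverse (integral {a..b} f) * f x)"
    using supp by (simp add: supp_in_def)
  ultimately show thesis
    using that test_cmult[OF test_functionI[OF smooth supp]] by blast
qed

section \<open>Primitives and smooth steps\<close>

lemma primitive_exists:
  assumes f: "f \<in> test_functions" and supp: "supp_in a b f" and "a \<le> b"
  obtains F where "smooth F" "nth_deriv 1 F = f" "\<And>x. x \<le> a \<Longrightarrow> F x = 0"
    "\<And>x. b \<le> x \<Longrightarrow> F x = integral {a..b} f"
proof -
  note cont = smooth_continuous_0[OF test_function_smooth[OF f]]
  \<comment> \<open>Starting at \<open>a - 1\<close> makes each \<open>x \<ge> a\<close> interior to
    the interval of integration, so the derivative is two-sided also at \<open>a\<close>.\<close>
  define F where "F x = integral {a - 1..x} f" for x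
  have F_left: "F x = 0" if "x \<le> a" for x
  proof -
    \<comment> \<open>\<open>supp_in a b f\<close> permits a nonzero value at the endpoint;
      continuity from the left excludes it.\<close>
    have "f a = 0"
    proof -
      have "(f \<longlongrightarrow> f a) (at_left a)"
        using cont[of UNIV] by (auto simp: continuous_on_def intro: tendsto_within_subset)
      moreover have "(f \<longlongrightarrow> 0) (at_left a)"
        by (rule tendsto_eventually) (use supp in \<open>auto simp: eventually_at_filter supp_in_def\<close>)
      ultimately show ?thesis
        using tendsto_unique trivial_limit_at_left_real by blast
    qed
    then have "f y = 0" if "y \<in> {a - 1..x}" for y
      using that \<open>x \<le> a\<close> supp by (cases "y = a") (auto simp: supp_in_def)
    then show ?thesis unfolding F_def using integral_cong[of "{a - 1..x}" f "\<lambda>x. 0"] by simp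
  qed
  have deriv: "(F has_vector_derivative f x) (at x)" for x
  proof (cases "x < a")
    case True
    have "((\<lambda>x. 0) has_vector_derivative f x) (at x)"
      using True supp by (simp add: supp_in_def)
    then show ?thesis
      by (rule has_vector_derivative_transform_within_open[of _ _ _ "{..<a}"])
        (use True F_left in auto)
  next
    case False
    have "(F has_vector_derivative f x) (at x within {a - 1..x + 1})"
      unfolding F_def[abs_def] using False by (intro integral_has_vector_derivative cont) auto
    then show ?thesis
      using False by (subst (asm) at_within_interior) auto
  qed
  have *: "deriv_seq (\<lambda>n. case n of 0 \<Rightarrow> F | Suc n \<Rightarrow> nth_deriv n f)"
    using deriv smooth_has_vector_derivative[OF test_function_smooth[OF f]]
    by (auto simp: deriv_seq_def split: nat.split)
  have "F x = integral {a..b} f" if "b \<le> x" for x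
  proof -
    have "integral {a - 1..x} f = (LINT y|lebesgue. f y)"
      by (intro lebesgue_integral_supp_in(2)[symmetric] cont supp_in_mono[OF supp]) (use that in auto)
    also have "\<dots> = integral {a..b} f"
      by (intro lebesgue_integral_supp_in(2) cont supp)
    finally show ?thesis by (simp add: F_def)
  qed
  then show thesis
    using that[of F] deriv_seq_smooth[OF *] deriv_seq_nth_deriv[OF *, of 1] F_left by simp
qed

text \<open>A primitive of a normalized bump: beyond order zero its derivatives are those of the
  bump, hence bounded although the step itself has no compact support.\<close>

lemma smooth_step_exists:
  assumes "a < b"
  obtains s where "smooth s" "\<And>x. x \<le> a \<Longrightarrow> s x = 0" "\<And>x. b \<le> x \<Longrightarrow> s x = 1"
    "\<And>n. bounded (range (nth_deriv n s))"
proof -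
  obtain f where f: "f \<in> test_functions" "supp_in a b f" "integral {a..b} f = 1"
    using bump_exists[OF assms] .
  obtain s where s: "smooth s" "nth_deriv 1 s = f" "\<And>x. x \<le> a \<Longrightarrow> s x = 0"
    "\<And>x. b \<le> x \<Longrightarrow> s x = integral {a..b} f"
    using primitive_exists[OF f(1,2)] assms by auto
  have "bounded (range (nth_deriv n s))" for n
  proof (cases n)
    case 0
    have "compact (s ` {a..b})"
      by (intro compact_continuous_image smooth_continuous_0 s(1)) auto
    then have "bounded (insert 0 (insert 1 (s ` {a..b})))"
      by (simp add: compact_imp_bounded)
    moreover have "s x \<in> insert 0 (insert 1 (s ` {a..b}))" for x
      using s(3)[of x] s(4)[of x] f(3) by (cases "x \<le> a"; cases "b \<le> x") auto
    then have "range s \<subseteq> insert 0 (insert 1 (s ` {a..b}))" by blast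
    ultimately show ?thesis unfolding 0 nth_deriv_0 by (rule bounded_subset)
  next
    case (Suc m)
    have "nth_deriv n s = nth_deriv m f"
      using smooth_nth_deriv(2)[OF s(1), of m 1] s(2) by (simp add: Suc)
    then show ?thesis
      using continuous_supp_bounded[OF smooth_continuous[OF test_function_smooth[OF f(1)]]
        supp_in_nth_deriv[OF f(2)]] by simp
  qed
  then show thesis using that[of s] s f(3) by simp
qed

lemma dil_1_integral:
  assumes "f \<in> test_functions" "supp_in 0 2 f"
  shows "integral {0..2} (dil 1 f) = integral {0..2} f"
proof -
  note cont = smooth_continuous_0[OF test_function_smooth[OF assms(1)]]
  have "(f has_integral integral {0..2} f) (cbox 0 2)"
    unfolding cbox_interval by (intro integrable_integral integrable_continuous_real cont)
  from has_integral_affinity'[OF this, of "2" 0]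
  have "((\<lambda>x. f (2 * x)) has_integral integral {0..2} f /\<^sub>R 2) {0..1}"
    by simp
  then have "((\<lambda>x. 2 * f (2 * x)) has_integral 2 * (integral {0..2} f /\<^sub>R 2)) {0..1}"
    by (rule has_integral_mult_right)
  then have "(dil 1 f has_integral integral {0..2} f) {0..1}"
    by (simp add: dil_def[abs_def] scaleR_conv_of_real)
  then have "integral {0..1} (dil 1 f) = integral {0..2} f"
    by (rule integral_unique)
  moreover have "continuous_on UNIV (dil 1 f)"
    by (intro smooth_continuous_0 dil_smooth test_function_smooth assms)
  moreover have "supp_in 0 1 (dil 1 f)" "supp_in 0 2 (dil 1 f)"
    using dil_supp[OF assms(2), of 1] dil_supp_0[OF assms(2)] by auto
  ultimately show ?thesis
    using lebesgue_integral_supp_in(2)[of "dil 1 f" 0 1] lebesgue_integral_supp_in(2)[of "dil 1 f" 0 2]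
    by simp
qed

lemma test_integral_diff:
  assumes "f \<in> test_functions" "g \<in> test_functions"
  shows "integral {a..b} (\<lambda>x. c * f x - d * g x) = c * integral {a..b} f - d * integral {a..b} g"
proof -
  have "(\<lambda>x. c * f x) integrable_on {a..b}" "(\<lambda>x. d * g x) integrable_on {a..b}"
    using assms
    by (auto intro!: integrable_continuous_real smooth_continuous_0 test_cmult test_function_smooth)
  then show ?thesis by (simp add: Henstock_Kurzweil_Integration.integral_diff)
qed

text \<open>Mean zero makes the primitive vanish again to the right of \<open>b\<close>.\<close>

lemma test_primitive_exists:
  assumes f: "f \<in> test_functions" "supp_in a b f" "a \<le> b" and 0: "integral {a..b} f = 0"
  obtains z where "z \<in> test_functions" "supp_in a b z" "nth_deriv 1 z = f"
proof -
  obtain z where z: "smooth z" "nth_deriv 1 z = f" "\<And>x. x \<le> a \<Longrightarrow> z x = 0"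
    "\<And>x. b \<le> x \<Longrightarrow> z x = integral {a..b} f"
    using primitive_exists[OF f] by blast
  have "supp_in a b z" using z(3,4) 0 by (auto simp: supp_in_def)
  with z show thesis using that test_functionI by blast
qed

text \<open>Replacing \<open>r\<close> by the normalized \<open>2^(K+1) dil 1 r - r\<close> kills one more moment
  of \<open>dil 1 r - r\<close>.\<close>

lemma mollifier_exists:
  obtains r z d where "r \<in> test_functions" "supp_in 0 2 r" "integral {0..2} r = 1"
    "d > 0" "\<And>x. x \<le> d \<Longrightarrow> r x = 0"
    "z \<in> test_functions" "supp_in 0 2 z" "\<And>x. dil 1 r x - r x = nth_deriv (Suc K) z x"
proof -
  have "\<exists>r z d. r \<in> test_functions \<and> supp_in 0 2 r \<and> integral {0..2} r = 1 \<and>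
    d > 0 \<and> (\<forall>x\<le>d. r x = 0) \<and> z \<in> test_functions \<and> supp_in 0 2 z \<and>
    (\<forall>x. dil 1 r x - r x = nth_deriv (Suc K) z x)"
  proof (induction K)
    case 0
    \<comment> \<open>A bump on \<open>[1, 2]\<close> provides the gap \<open>d\<close> to the right
      of 0 that causality will use.\<close>
    obtain r where r: "r \<in> test_functions" "supp_in 1 2 r" "integral {1..2} r = 1"
      using bump_exists[of 1 2] by auto
    have r2: "supp_in 0 2 r" using r(2) by (rule supp_in_mono) auto
    note cont = smooth_continuous_0[OF test_function_smooth[OF r(1)]]
    have i: "integral {0..2} r = 1"
      using lebesgue_integral_supp_in(2)[OF cont r(2)] lebesgue_integral_supp_in(2)[OF cont r2] r(3)
      by simp
    have "(\<lambda>x. dil 1 r x - r x) \<in> test_functions"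
      by (intro test_diff dil_test r)
    moreover have "supp_in 0 2 (\<lambda>x. dil 1 r x - r x)"
      using r2 dil_supp_0[OF r2, of 1] by (simp add: supp_in_def)
    moreover have "integral {0..2} (\<lambda>x. dil 1 r x - r x) = 0"
      using test_integral_diff[OF dil_test[OF r(1), of 1] r(1), of 0 2 1 1]
        dil_1_integral[OF r(1) r2] by simp
    ultimately obtain z where z: "z \<in> test_functions" "supp_in 0 2 z"
      "nth_deriv 1 z = (\<lambda>x. dil 1 r x - r x)"
      using test_primitive_exists[of _ 0 2] by auto
    have "\<forall>x\<le>1/2. r x = 0" using r(2) by (simp add: supp_in_def)
    then show ?case using r(1) r2 i z by (intro exI[of _ r] exI[of _ z] exI[of _ "1/2"]) simp
  next
    case (Suc K)
    then obtain r z d where r: "r \<in> test_functions" "supp_in 0 2 r" "integral {0..2} r = 1"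
      and d: "d > 0" "\<And>x. x \<le> d \<Longrightarrow> r x = 0"
      and z: "z \<in> test_functions" "supp_in 0 2 z"
      and rz: "\<And>x. dil 1 r x - r x = nth_deriv (Suc K) z x" by blast
    \<comment> \<open>\<open>c\<close> is the factor with \<open>c * dil 1 (nth_deriv (Suc K) z) =
      nth_deriv (Suc K) (dil 1 z)\<close>, so that the new difference becomes
      \<open>nth_deriv (Suc K) w\<close>.\<close>
    define c :: complex where "c = 2 ^ Suc K"
    have c: "c \<noteq> 1"
    proof
      assume "c = 1"
      then have "cmod c = 1" by simp
      then have "(2::real) ^ Suc K = 1" unfolding c_def norm_power by simp
      then show False using one_less_power[of "2::real" "Suc K"] by simp
    qed
    define r' where "r' = (\<lambda>x. c / (c - 1) * dil 1 r x - 1 / (c - 1) * r x)"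
    define w where "w = (\<lambda>x. 1 / (c - 1) * dil 1 z x - 1 / (c - 1) * z x)"
    note sz = test_function_smooth[OF z(1)]
    have r'1: "r' \<in> test_functions" unfolding r'_def by (intro test_diff test_cmult dil_test r)
    have r'2: "supp_in 0 2 r'"
      using r(2) dil_supp_0[OF r(2), of 1] by (simp add: supp_in_def r'_def)
    have "integral {0..2} r' = c / (c - 1) * 1 - 1 / (c - 1) * 1"
      unfolding r'_def test_integral_diff[OF dil_test[OF r(1)] r(1)] dil_1_integral[OF r(1,2)] r(3) ..
    then have r'3: "integral {0..2} r' = 1" using c by (simp add: diff_divide_distrib[symmetric])
    \<comment> \<open>The gap halves because \<open>dil 1 r\<close> is known to vanish only up to
      \<open>d / 2\<close>.\<close>
    have d': "r' x = 0" if "x \<le> d / 2" for x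
      using that d by (simp add: r'_def dil_def)
    have w: "w \<in> test_functions" unfolding w_def by (intro test_diff test_cmult dil_test z)
    have "supp_in 0 2 w"
      using z(2) dil_supp_0[OF z(2), of 1] by (simp add: supp_in_def w_def)
    \<comment> \<open>Dilation keeps the integral, so \<open>w\<close> has mean zero and is itself a
      derivative: this is the additional order.\<close>
    moreover have "integral {0..2} w = 0"
      unfolding w_def test_integral_diff[OF dil_test[OF z(1)] z(1)] dil_1_integral[OF z] by simp
    ultimately obtain z' where z': "z' \<in> test_functions" "supp_in 0 2 z'" "nth_deriv 1 z' = w"
      using test_primitive_exists[OF w, of 0 2] by auto
    have "dil 1 r' x - r' x = nth_deriv (Suc (Suc K)) z' x" for x
    proof -
      have "dil 1 r' x - r' x = 1 / (c - 1) * (c * (2 * (dil 1 r (2 * x) - r (2 * x))) - (dil 1 r x - r x))"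
        using c by (simp add: r'_def dil_def divide_simps) (simp add: algebra_simps)
      also have "\<dots> = 1 / (c - 1) * (c * 2 * nth_deriv (Suc K) z (2 * x)) - 1 / (c - 1) * nth_deriv (Suc K) z x"
        unfolding rz by (simp add: algebra_simps)
      also have "c * 2 * nth_deriv (Suc K) z (2 * x) = nth_deriv (Suc K) (dil 1 z) x"
        by (simp add: dil_smooth(2)[OF sz] c_def)
      also have "1 / (c - 1) * nth_deriv (Suc K) (dil 1 z) x - 1 / (c - 1) * nth_deriv (Suc K) z x
          = nth_deriv (Suc K) w x"
        unfolding w_def smooth_diff(2)[OF smooth_cmult(1)[OF dil_smooth(1)[OF sz]] smooth_cmult(1)[OF sz]]
          smooth_cmult(2)[OF sz] smooth_cmult(2)[OF dil_smooth(1)[OF sz]] ..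
      also have "\<dots> = nth_deriv (Suc (Suc K)) z' x"
        using smooth_nth_deriv(2)[OF test_function_smooth[OF z'(1)], of "Suc K" 1] z'(3) by simp
      finally show ?thesis .
    qed
    then show ?case
      using r'1 r'2 r'3 d' d(1) z'(1,2)
      by (intro exI[of _ r'] exI[of _ z'] exI[of _ "d / 2"]) auto
  qed
  then show thesis using that by blast
qed

subsection \<open>Convolution with a test function\<close>

lemma has_derivative_tensor:
  assumes f: "smooth f" and g: "smooth g"
  shows "((\<lambda>z. nth_deriv i f (fst z) * nth_deriv j g (snd z)) has_derivative
    (\<lambda>h. nth_deriv i f (fst z) * (snd h *\<^sub>R nth_deriv (Suc j) g (snd z)) +
      fst h *\<^sub>R nth_deriv (Suc i) f (fst z) * nth_deriv j g (snd z))) (at z)"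
proof (rule has_derivative_mult)
  have "(nth_deriv i f has_derivative (\<lambda>h. h *\<^sub>R nth_deriv (Suc i) f (fst z))) (at (fst z))"
    using smooth_has_vector_derivative[OF f] by (simp add: has_vector_derivative_def)
  from has_derivative_compose[OF has_derivative_fst[OF has_derivative_ident] this]
  show "((\<lambda>z. nth_deriv i f (fst z)) has_derivative (\<lambda>h. fst h *\<^sub>R nth_deriv (Suc i) f (fst z))) (at z)" .
  have "(nth_deriv j g has_derivative (\<lambda>h. h *\<^sub>R nth_deriv (Suc j) g (snd z))) (at (snd z))"
    using smooth_has_vector_derivative[OF g] by (simp add: has_vector_derivative_def)
  from has_derivative_compose[OF has_derivative_snd[OF has_derivative_ident] this]
  show "((\<lambda>z. nth_deriv j g (snd z)) has_derivative (\<lambda>h. snd h *\<^sub>R nth_deriv (Suc j) g (snd z))) (at z)" .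
qed

text \<open>On a product of functions of one variable, a list of basis directions acts only through
  the number of occurrences of each direction.\<close>

lemma partial_derivs_tensor:
  fixes f g :: "real \<Rightarrow> complex"
  assumes f: "smooth f" and g: "smooth g" and "vs \<in> lists Basis"
  shows "partial_derivs vs (\<lambda>z. f (fst z) * g (snd z)) =
    (\<lambda>z. nth_deriv (count_list vs (1, 0)) f (fst z) * nth_deriv (count_list vs (0, 1)) g (snd z))"
  using assms(3)
proof (induction vs)
  case Nil
  then show ?case by (simp add: partial_derivs_def)
next
  case (Cons v vs)
  define i j where "i = count_list vs (1, 0)" and "j = count_list vs (0::real, 1::real)"
  let ?F = "\<lambda>z. nth_deriv i f (fst z) * nth_deriv j g (snd z)"
  have 1: "partial_derivs (v # vs) (\<lambda>z. f (fst z) * g (snd z)) = (\<lambda>z. frechet_derivative ?F (at z) v)"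
    using Cons by (simp add: partial_derivs_def i_def j_def)
  have 2: "frechet_derivative ?F (at z) v = nth_deriv i f (fst z) * (snd v *\<^sub>R nth_deriv (Suc j) g (snd z)) +
      fst v *\<^sub>R nth_deriv (Suc i) f (fst z) * nth_deriv j g (snd z)" for z
    by (subst frechet_derivative_at[OF has_derivative_tensor[OF f g], symmetric]) (rule refl)
  have "v = (1, 0) \<or> v = (0, 1)"
    using Cons by (auto simp: Basis_prod_def)
  then show ?case
    unfolding 1 2 by (auto simp: i_def j_def)
qed

text \<open>\<open>is_convolution\<close> quantifies over all unit sequences, so it determines the
  limit only because at least one exists.\<close>

lemma unit_sequence_exists:
  obtains w where "\<And>k. w k \<in> test_functions"
    "unit_sequence (\<lambda>k z. w k (fst z) * w k (snd z))"
proof -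
  obtain s where s: "smooth s" "\<And>x. x \<le> -1 \<Longrightarrow> s x = 0" "\<And>x. 0 \<le> x \<Longrightarrow> s x = 1"
    "\<And>n. bounded (range (nth_deriv n s))"
    using smooth_step_exists[of "-1" 0] by auto
  \<comment> \<open>One step up near \<open>- k\<close> and one down near \<open>k\<close>, both of
    a shape independent of \<open>k\<close>; this keeps the derivative bounds uniform.\<close>
  define w where "w k x = s (1 * x + real k) - s (1 * x + - real k)" for k :: nat and x
  have w_smooth: "smooth (w k)" for k
    unfolding w_def by (intro smooth_diff smooth_affine s(1))
  have w_supp: "supp_in (- real k - 1) k (w k)" for k
    by (auto simp: supp_in_def w_def s(2,3))
  have w_1: "w k x = 1" if "- real k \<le> x" "x \<le> real k - 1" for k x
    using that by (simp add: w_def s(2,3))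
  have w_bound: "\<exists>B. \<forall>k x. cmod (nth_deriv n (w k) x) \<le> B" for n
  proof -
    obtain B where B: "\<And>x. cmod (nth_deriv n s x) \<le> B"
      using s(4)[of n] by (auto simp: bounded_iff)
    have e: "nth_deriv n (w k) x = nth_deriv n s (x + k) - nth_deriv n s (x - k)" for k x
      unfolding w_def[abs_def] smooth_diff(2)[OF smooth_affine(1)[OF s(1)] smooth_affine(1)[OF s(1)]]
        smooth_affine(2)[OF s(1)] by simp
    have "cmod (nth_deriv n (w k) x) \<le> B + B" for k x
      unfolding e using norm_triangle_ineq4 B by (meson add_mono order_trans)
    then show ?thesis by blast
  qed
  have "(\<lambda>z. w k (fst z) * w k (snd z)) \<in> test_functions_plane" for k
  proof -
    have "{z. w k (fst z) * w k (snd z) \<noteq> 0} \<subseteq> {- real k - 1..k} \<times> {- real k - 1..k}"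
      using w_supp[of k] by (force simp: supp_in_def)
    then have "bounded {z. w k (fst z) * w k (snd z) \<noteq> 0}"
      by (rule bounded_subset[rotated]) (intro bounded_Times bounded_closed_interval)
    then have "compact (fun_support (\<lambda>z. w k (fst z) * w k (snd z)))"
      by (simp add: fun_support_def compact_eq_bounded_closed bounded_closure)
    moreover have "(\<lambda>z. nth_deriv i (w k) (fst z) * nth_deriv j (w k) (snd z)) differentiable (at z)"
      for i j and z :: "real \<times> real"
      using has_derivative_tensor[OF w_smooth w_smooth] by (rule differentiableI)
    ultimately show ?thesis
      by (simp add: test_functions_plane_def partial_derivs_tensor[OF w_smooth w_smooth])
  qed
  moreover have "\<forall>\<^sub>F k in sequentially. \<forall>z\<in>K. w k (fst z) * w k (snd z) = 1" if "compact K" for K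
  proof -
    obtain r where r: "\<And>z. z \<in> K \<Longrightarrow> norm z \<le> r"
      using compact_imp_bounded[OF \<open>compact K\<close>] by (auto simp: bounded_iff)
    have "\<forall>\<^sub>F k in sequentially. r + 1 \<le> real k"
      using filterlim_real_sequentially unfolding filterlim_at_top by blast
    then show ?thesis
    proof eventually_elim
      case (elim k)
      show ?case
      proof
        fix z assume "z \<in> K"
        then have "\<bar>fst z\<bar> \<le> r" "\<bar>snd z\<bar> \<le> r"
          using r[of z] norm_fst_le[of "fst z" "snd z"] norm_snd_le[of "snd z" "fst z"] by auto
        then show "w k (fst z) * w k (snd z) = 1"
          using elim by (simp add: w_1)
      qed
    qed
  qed
  moreover have "\<exists>C. \<forall>k z. norm (partial_derivs vs (\<lambda>z. w k (fst z) * w k (snd z)) z) \<le> C"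
    if "vs \<in> lists Basis" for vs
  proof -
    obtain B where B: "\<And>k x. cmod (nth_deriv (count_list vs (1, 0)) (w k) x) \<le> B"
      using w_bound by blast
    obtain C where C: "\<And>k x. cmod (nth_deriv (count_list vs (0, 1)) (w k) x) \<le> C"
      using w_bound by blast
    show ?thesis
      unfolding partial_derivs_tensor[OF w_smooth w_smooth that] norm_mult
      using B C order_trans[OF norm_ge_zero B] by (intro exI[of _ "B * C"] allI mult_mono) auto
  qed
  ultimately have "unit_sequence (\<lambda>k z. w k (fst z) * w k (snd z))"
    unfolding unit_sequence_def by blast
  then show thesis
    using that test_functionI[OF w_smooth w_supp] by blast
qed

text \<open>The integrand \<open>f y * g (x + y)\<close> lives on a compact box where the cut-offs
  are eventually 1, so the sequence defining the convolution is eventually constant.\<close>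

lemma convolution_operator_dist_of:
  assumes conv: "convolution_operator Y (dist_of f) = Some (dist_of \<psi>)"
    and f: "f \<in> test_functions" and g: "g \<in> test_functions"
  shows "Y (corr f g) = (LINT t|lebesgue. \<psi> t * g t)"
proof -
  obtain w where w: "\<And>k. w k \<in> test_functions"
    and unit: "unit_sequence (\<lambda>k z. w k (fst z) * w k (snd z))"
    using unit_sequence_exists by blast
  let ?\<eta> = "\<lambda>k z. w k (fst z) * w k (snd z)"
  \<comment> \<open>Both values are the limit of one sequence, taken along the unit sequence just
    obtained; this is what makes \<open>THE\<close> meaningful.\<close>
  have unique: "V = W" if "is_convolution Y U V" "is_convolution Y U W" for U V W
  proof (rule extensionalityI)
    show "V \<in> extensional test_functions" "W \<in> extensional test_functions"
      using that by (auto simp: is_convolution_def distributions_def)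
    fix \<phi> assume "\<phi> \<in> test_functions"
    then show "V \<phi> = W \<phi>"
      using that unit unfolding is_convolution_def by (blast intro: LIMSEQ_unique)
  qed
  have "\<exists>W. is_convolution Y (dist_of f) W"
    and "(THE W. is_convolution Y (dist_of f) W) = dist_of \<psi>"
    using conv by (auto simp: convolution_operator_def split: if_splits)
  then have "is_convolution Y (dist_of f) (dist_of \<psi>)"
    using theI'[of "is_convolution Y (dist_of f)"] unique by metis
  then have lim: "(\<lambda>k. Y (\<lambda>x. dist_of f (\<lambda>y. ?\<eta> k (x, y) * g (x + y)))) \<longlonglongrightarrow> dist_of \<psi> g"
    using g unit unfolding is_convolution_def by blast
  obtain r where r: "supp_in (-r) r f" by (rule test_function_supp[OF f])
  obtain s where s: "supp_in (-s) s g" by (rule test_function_supp[OF g])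
  \<comment> \<open>\<open>y \<in> {-r..r}\<close> and \<open>x + y \<in> {-s..s}\<close> force
    \<open>x \<in> {-(r + s)..r + s}\<close>.\<close>
  have "compact ({-(r + s)..r + s} \<times> {-r..r})"
    by (intro compact_Times compact_Icc)
  then have "\<forall>\<^sub>F k in sequentially. \<forall>z\<in>{-(r + s)..r + s} \<times> {-r..r}. ?\<eta> k z = 1"
    using unit unfolding unit_sequence_def by blast
  then have "\<forall>\<^sub>F k in sequentially. Y (\<lambda>x. dist_of f (\<lambda>y. ?\<eta> k (x, y) * g (x + y))) = Y (corr f g)"
  proof eventually_elim
    case (elim k)
    have "dist_of f (\<lambda>y. ?\<eta> k (x, y) * g (x + y)) = corr f g x" for x
    proof -
      have sg: "smooth (\<lambda>y. g (x + y))"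
        using smooth_affine(1)[OF test_function_smooth[OF g], of 1 x] by (simp add: add.commute)
      have "supp_in (- s - x) (s - x) (\<lambda>y. ?\<eta> k (x, y) * g (x + y))"
        using s by (auto simp: supp_in_def)
      moreover have "smooth (\<lambda>y. ?\<eta> k (x, y) * g (x + y))"
        using smooth_mult(1)[OF smooth_cmult(1)[OF test_function_smooth[OF w[of k]], of "w k x"] sg] by simp
      \<comment> \<open>\<open>dist_of f\<close> is given by the integral only on test functions, so
        the slice in \<open>y\<close> must be shown to be one.\<close>
      ultimately have "(\<lambda>y. ?\<eta> k (x, y) * g (x + y)) \<in> test_functions"
        by (metis test_functionI)
      moreover have "f y * (?\<eta> k (x, y) * g (x + y)) = f y * g (x + y)" for y
      proof (cases "y \<in> {-r..r} \<and> x + y \<in> {-s..s}")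
        case True
        then have "(x, y) \<in> {-(r + s)..r + s} \<times> {-r..r}" by auto
        with elim have "?\<eta> k (x, y) = 1" by blast
        then show ?thesis by simp
      qed (use r s in \<open>auto simp: supp_in_def\<close>)
      then have "(\<lambda>y. f y * (?\<eta> k (x, y) * g (x + y))) = (\<lambda>y. f y * g (x + y))" by blast
      ultimately show ?thesis
        by (simp only: dist_of_def corr_def restrict_def if_True)
    qed
    then show ?case by (simp add: fun_eq_iff[symmetric])
  qed
  from tendsto_unique[OF _ tendsto_eventually[OF this] lim] show ?thesis
    using g by (simp add: dist_of_def)
qed

section \<open>Linearity, convergence criterion and finite order of distributions\<close>

lemma distribution_add:
  "Y \<in> distributions \<Longrightarrow> f \<in> test_functions \<Longrightarrow> g \<in> test_functions \<Longrightarrow>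
    Y (\<lambda>x. f x + g x) = Y f + Y g"
  by (simp add: distributions_def linear_functional_on_def)

lemma distribution_cmult:
  "Y \<in> distributions \<Longrightarrow> f \<in> test_functions \<Longrightarrow> Y (\<lambda>x. a * f x) = a * Y f"
  by (simp add: distributions_def linear_functional_on_def)

lemma distribution_diff:
  assumes "Y \<in> distributions" "f \<in> test_functions" "g \<in> test_functions"
  shows "Y (\<lambda>x. f x - g x) = Y f - Y g"
  using distribution_add[OF assms(1,2) test_cmult[OF assms(3), of "-1"]]
    distribution_cmult[OF assms(1,3), of "-1"] by simp

lemma distribution_0: "Y \<in> distributions \<Longrightarrow> Y (\<lambda>x. 0) = 0"
  using distribution_cmult[of Y "\<lambda>x. 0" 0] test_functionI[of "\<lambda>x. 0" 0 0]
  by (simp add: smooth_const supp_in_def)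

text \<open>The rate \<open>e\<close> is common to all derivatives, while \<open>C k\<close> may
  depend on the order. The restriction \<open>k \<le> n\<close> admits sequences whose
  \<open>n\<close>th member is controlled only up to order \<open>n\<close>.\<close>

lemma tendsto_testI:
  assumes "\<And>n. F n \<in> test_functions" "f \<in> test_functions" "\<And>n. supp_in a b (F n)"
    and bound: "\<And>k n x. k \<le> n \<Longrightarrow> cmod (nth_deriv k (F n) x - nth_deriv k f x) \<le> C k * e n"
    and e: "e \<longlonglongrightarrow> 0"
  shows "tendsto_test F f"
  unfolding tendsto_test_def
proof (intro conjI allI)
  show "\<exists>K. compact K \<and> (\<forall>n. fun_support (F n) \<subseteq> K)"
    using assms(3) unfolding supp_in_fun_support by blast
  fix k
  have "(\<lambda>n. C k * e n) \<longlonglongrightarrow> 0" using tendsto_mult_right_zero[OF e] .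
  show "uniform_limit UNIV (\<lambda>n. nth_deriv k (F n)) (nth_deriv k f) sequentially"
  proof (rule uniform_limitI)
    fix \<epsilon> :: real assume "\<epsilon> > 0"
    have "\<forall>\<^sub>F n in sequentially. C k * e n < \<epsilon>"
      using order_tendstoD(2)[OF \<open>(\<lambda>n. C k * e n) \<longlonglongrightarrow> 0\<close> \<open>\<epsilon> > 0\<close>] .
    then show "\<forall>\<^sub>F n in sequentially. \<forall>x\<in>UNIV. dist (nth_deriv k (F n) x) (nth_deriv k f x) < \<epsilon>"
      using eventually_ge_at_top[of k]
      by eventually_elim (auto simp: dist_norm intro: le_less_trans[OF bound])
  qed
qed (use assms in auto)

text \<open>Otherwise there is a counterexample for each order \<open>n\<close>; divided by
  \<open>(n + 1) * B n\<close>, these tend to 0 as test functions while the values of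
  \<open>Y\<close> stay away from 0.\<close>

lemma distribution_finite_order:
  assumes Y: "Y \<in> distributions"
  obtains C M where "C > 0" "\<And>f B. f \<in> test_functions \<Longrightarrow> supp_in l u f \<Longrightarrow> B > 0 \<Longrightarrow>
    deriv_bound M B f \<Longrightarrow> cmod (Y f) \<le> C * B"
proof -
  \<comment> \<open>One number serves as order and, increased by 1, as constant, so that the
    negation yields a sequence.\<close>
  have "\<exists>M. \<forall>f B. f \<in> test_functions \<longrightarrow> supp_in l u f \<longrightarrow> B > 0 \<longrightarrow>
    deriv_bound M B f \<longrightarrow> cmod (Y f) \<le> (real M + 1) * B"
  proof (rule ccontr)
    assume "\<not> ?thesis"
    then obtain f B where f: "\<And>n. f n \<in> test_functions" "\<And>n. supp_in l u (f n)" and B: "\<And>n. B n > 0"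
      and bound: "\<And>n. deriv_bound n (B n) (f n)" and large: "\<And>n. cmod (Y (f n)) > (real n + 1) * B n"
      unfolding not_ex not_all not_imp not_le by metis
    define a :: "nat \<Rightarrow> real" where "a n = inverse ((real n + 1) * B n)" for n
    define g where "g n = (\<lambda>x. complex_of_real (a n) * f n x)" for n
    have g: "g n \<in> test_functions" for n unfolding g_def by (intro test_cmult f)
    have a: "a n > 0" for n using B by (simp add: a_def)
    have "tendsto_test g (\<lambda>x. 0)"
    proof (rule tendsto_testI[where C = "\<lambda>k. 1" and e = "\<lambda>n. 1 / (real n + 1)"])
      show "(\<lambda>x. 0) \<in> test_functions"
        using test_functionI[of "\<lambda>x. 0" 0 0] by (simp add: smooth_const supp_in_def)
      show "supp_in l u (g n)" for n using f(2)[of n] unfolding supp_in_def g_def by simp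
      show "(\<lambda>n. 1 / (real n + 1)) \<longlonglongrightarrow> 0"
        using LIMSEQ_inverse_real_of_nat by (simp add: inverse_eq_divide add.commute)
      fix k n x assume "k \<le> (n::nat)"
      have "cmod (nth_deriv k (g n) x) = a n * cmod (nth_deriv k (f n) x)"
        unfolding g_def smooth_cmult(2)[OF test_function_smooth[OF f(1)]] norm_mult using a[of n] by simp
      also have "\<dots> \<le> a n * B n"
        using a[of n] deriv_boundD[OF bound \<open>k \<le> n\<close>] by (intro mult_left_mono) auto
      also have "\<dots> = 1 / (real n + 1)" using B[of n] by (simp add: a_def divide_inverse)
      finally show "cmod (nth_deriv k (g n) x - nth_deriv k (\<lambda>x. 0) x) \<le> 1 * (1 / (real n + 1))" by simp
    qed (fact g)
    then have "(\<lambda>n. Y (g n)) \<longlonglongrightarrow> 0"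
      using Y distribution_0[OF Y] unfolding distributions_def by fastforce
    from tendstoD[OF this zero_less_one] have "\<forall>\<^sub>F n in sequentially. cmod (Y (g n)) < 1"
      by simp
    moreover have "\<not> cmod (Y (g n)) < 1" for n
    proof -
      have "cmod (Y (g n)) = a n * cmod (Y (f n))"
        unfolding g_def distribution_cmult[OF Y f(1)] norm_mult using a[of n] by simp
      moreover have "a n * ((real n + 1) * B n) \<le> a n * cmod (Y (f n))"
        using a[of n] large[of n] by (intro mult_left_mono) auto
      moreover have "a n * ((real n + 1) * B n) = 1"
        unfolding a_def by (intro left_inverse) (use B[of n] in auto)
      ultimately show ?thesis by simp
    qed
    ultimately show False by simp
  qed
  then obtain M where "\<forall>f B. f \<in> test_functions \<longrightarrow> supp_in l u f \<longrightarrow> B > 0 \<longrightarrow>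
    deriv_bound M B f \<longrightarrow> cmod (Y f) \<le> (real M + 1) * B" ..
  then show thesis using that[of "real M + 1" M] by simp
qed

subsection \<open>Causality\<close>

text \<open>In the double mollification the intermediate function enters with the derivative bound
  \<open>2 * F * G k\<close>, which is independent of \<open>j\<close>; the second error is
  therefore again of size \<open>2 ^ -j\<close>.\<close>

lemma mollify_error:
  assumes r: "r \<in> test_functions" "supp_in 0 2 r" "integral {0..2} r = 1"
    and g: "g \<in> test_functions"
  obtains C where "\<And>k j x. cmod (nth_deriv k (corr (dil j r) g) x - nth_deriv k g x) \<le> C k * (1 / 2 ^ j)"
    "\<And>k j x. cmod (nth_deriv k (corr (dil j r) (corr (dil j r) g)) x - nth_deriv k g x) \<le> C k * (1 / 2 ^ j)"
proof -
  note sr = test_function_smooth[OF r(1)] and sg = test_function_smooth[OF g]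
  obtain F where F: "F > 0" "\<And>x. cmod (r x) \<le> F"
    using test_function_deriv_bound[OF r(1), of 0] deriv_bound_0D by metis
  have "\<exists>G. \<forall>x. cmod (nth_deriv (Suc k) g x) \<le> G" for k
    using test_function_deriv_bound[OF g, of "Suc k"] deriv_boundD by (metis order_refl)
  then obtain G where G: "\<And>k x. cmod (nth_deriv (Suc k) g x) \<le> G k" by metis
  have G0: "G k \<ge> 0" for k using order_trans[OF norm_ge_zero G] .
  have e1: "cmod (corr (dil j r) (nth_deriv k g) x - nth_deriv k g x) \<le> 4 * F * G k / 2 ^ j" for j k x
    by (rule dil_corr_approx[OF sr r(2,3) smooth_nth_deriv(1)[OF sg] F(2)])
      (use G in \<open>simp add: smooth_nth_deriv(2)[OF sg]\<close>)
  have d1: "nth_deriv k (corr (dil j r) g) = corr (dil j r) (nth_deriv k g)" for j k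
    by (rule test_corr_smooth(2)[OF dil_test[OF r(1)] sg])
  have s1: "smooth (corr (dil j r) (nth_deriv k g))" for j k
    by (rule test_corr_smooth(1)[OF dil_test[OF r(1)] smooth_nth_deriv(1)[OF sg]])
  have "cmod (nth_deriv 1 (corr (dil j r) (nth_deriv k g)) x) \<le> 2 * F * G k" for j k x
  proof -
    have "nth_deriv 1 (corr (dil j r) (nth_deriv k g)) = corr (dil j r) (nth_deriv (Suc k) g)"
      using test_corr_smooth(2)[OF dil_test[OF r(1)] smooth_nth_deriv(1)[OF sg], of 1]
      by (simp add: smooth_nth_deriv(2)[OF sg])
    then show ?thesis
      using dil_corr_bound[OF sr r(2) smooth_continuous[OF sg] F(2) G] by simp
  qed
  then have e2: "cmod (corr (dil j r) (corr (dil j r) (nth_deriv k g)) x - corr (dil j r) (nth_deriv k g) x)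
      \<le> 4 * F * (2 * F * G k) / 2 ^ j" for j k x
    by (rule dil_corr_approx[OF sr r(2,3) s1 F(2)])
  have d2: "nth_deriv k (corr (dil j r) (corr (dil j r) g)) = corr (dil j r) (corr (dil j r) (nth_deriv k g))" for j k
    using test_corr_smooth(2)[OF dil_test[OF r(1)] s1[of _ 0]] by (simp add: d1)
  define C where "C k = 4 * F * (2 * F * G k) + 4 * F * G k" for k
  show thesis
  proof (rule that[of C])
    fix k j x
    have "4 * F * G k / 2 ^ j \<le> C k / 2 ^ j"
      using F(1) G0[of k] by (intro divide_right_mono) (auto simp: C_def)
    with e1[of j k x] show "cmod (nth_deriv k (corr (dil j r) g) x - nth_deriv k g x) \<le> C k * (1 / 2 ^ j)"
      by (simp add: d1)
    have "cmod (corr (dil j r) (corr (dil j r) (nth_deriv k g)) x - nth_deriv k g x)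
        \<le> 4 * F * (2 * F * G k) / 2 ^ j + 4 * F * G k / 2 ^ j"
      using norm_triangle_mono[OF e2[of j k x] e1[of j k x]] by simp
    then show "cmod (nth_deriv k (corr (dil j r) (corr (dil j r) g)) x - nth_deriv k g x) \<le> C k * (1 / 2 ^ j)"
      by (simp add: d2 C_def add_divide_distrib)
  qed
qed

lemma distribution_mollify:
  assumes Y: "Y \<in> distributions"
    and r: "r \<in> test_functions" "supp_in 0 2 r" "integral {0..2} r = 1"
    and g: "g \<in> test_functions"
  shows "(\<lambda>j. Y (corr (dil j r) g)) \<longlonglongrightarrow> Y g"
    "(\<lambda>j. Y (corr (dil j r) (corr (dil j r) g))) \<longlonglongrightarrow> Y g"
proof -
  obtain C where C:
    "\<And>k j x. cmod (nth_deriv k (corr (dil j r) g) x - nth_deriv k g x) \<le> C k * (1 / 2 ^ j)"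
    "\<And>k j x. cmod (nth_deriv k (corr (dil j r) (corr (dil j r) g)) x - nth_deriv k g x) \<le> C k * (1 / 2 ^ j)"
    using mollify_error[OF r g] by blast
  have e: "(\<lambda>j. 1 / 2 ^ j :: real) \<longlonglongrightarrow> 0"
    using LIMSEQ_power_zero[of "1 / 2 :: real"] by (simp add: power_one_over)
  obtain s where s: "supp_in (-s) s g" by (rule test_function_supp[OF g])
  have s1: "supp_in (- s - 2) s (corr (dil j r) g)" for j
    using corr_supp[OF dil_supp_0[OF r(2)] s] by simp
  have s2: "supp_in (- 4 - s) s (corr (dil j r) (corr (dil j r) g))" for j
    using corr_supp[OF dil_supp_0[OF r(2)] s1] by simp
  have "tendsto_test (\<lambda>j. corr (dil j r) g) g"
    by (rule tendsto_testI[OF test_corr[OF dil_test[OF r(1)] g] g s1 C(1) e])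
  then show "(\<lambda>j. Y (corr (dil j r) g)) \<longlonglongrightarrow> Y g"
    using Y by (simp add: distributions_def)
  have "tendsto_test (\<lambda>j. corr (dil j r) (corr (dil j r) g)) g"
    by (rule tendsto_testI[OF test_corr[OF dil_test[OF r(1)] test_corr[OF dil_test[OF r(1)] g]] g s2 C(2) e])
  then show "(\<lambda>j. Y (corr (dil j r) (corr (dil j r) g))) \<longlonglongrightarrow> Y g"
    using Y by (simp add: distributions_def)
qed

text \<open>What is kept of the convolution operator: \<open>\<psi>\<close> represents
  \<open>Y (corr f g)\<close> as a functional of \<open>g\<close>.\<close>

locale passive_distribution =
  fixes Y :: "(real \<Rightarrow> complex) \<Rightarrow> complex" and N :: nat and c :: "nat \<Rightarrow> real"
  assumes Y: "Y \<in> distributions"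
    and passivity: "\<And>t f. f \<in> test_functions \<Longrightarrow>
      \<exists>\<psi>. (\<forall>g\<in>test_functions. Y (corr f g) = (LINT x|lebesgue. \<psi> x * g x)) \<and>
        (\<Sum>j\<le>N. c j * (LINT \<tau>:{..t}|lebesgue. (cmod (nth_deriv j f \<tau>))\<^sup>2))
          \<le> Re (LINT \<tau>:{..t}|lebesgue. cnj (f \<tau>) * \<psi> \<tau>)"
begin

text \<open>If \<open>f\<close> cut at \<open>t\<close> is again a test function \<open>g\<close>,
  its conjugate may be paired with \<open>\<psi>\<close>, and the cut-off integral becomes a value
  of \<open>Y\<close>. Applied below with \<open>g\<close> one summand of \<open>f\<close> at
  \<open>t = 0\<close>, and with \<open>g\<close> equal to \<open>f\<close> at \<open>t\<close>
  beyond the support.\<close>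

lemma passive_truncated:
  assumes f: "f \<in> test_functions" and g: "g \<in> test_functions"
    and fg: "\<And>x. x \<le> t \<Longrightarrow> g x = f x" "\<And>x. t < x \<Longrightarrow> g x = 0"
  shows "(\<Sum>j\<le>N. c j * (LINT \<tau>:{..t}|lebesgue. (cmod (nth_deriv j f \<tau>))\<^sup>2))
    \<le> Re (Y (corr f (\<lambda>x. cnj (g x))))"
proof -
  obtain \<psi> where "\<forall>g\<in>test_functions. Y (corr f g) = (LINT x|lebesgue. \<psi> x * g x)"
    and le: "(\<Sum>j\<le>N. c j * (LINT \<tau>:{..t}|lebesgue. (cmod (nth_deriv j f \<tau>))\<^sup>2))
          \<le> Re (LINT \<tau>:{..t}|lebesgue. cnj (f \<tau>) * \<psi> \<tau>)"
    using passivity[OF f] by blast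
  then have 1: "Y (corr f (\<lambda>x. cnj (g x))) = (LINT x|lebesgue. \<psi> x * cnj (g x))"
    using test_cnj[OF g] by blast
  have "indicat_real {..t} x *\<^sub>R (cnj (f x) * \<psi> x) = \<psi> x * cnj (g x)" for x
    using fg[of x] by (cases "x \<le> t") auto
  then have "(LINT \<tau>:{..t}|lebesgue. cnj (f \<tau>) * \<psi> \<tau>) = (LINT x|lebesgue. \<psi> x * cnj (g x))"
    by (simp add: set_lebesgue_integral_def)
  with 1 le show ?thesis by simp
qed

text \<open>The signs of the \<open>c j\<close> are unknown, so they enter as
  \<open>\<bar>c j\<bar>\<close>; \<open>A\<close> is meant to enclose the part of the support up to
  \<open>t\<close>.\<close>

lemma energy_bound:
  assumes A: "A \<in> lmeasurable" and "0 \<le> E"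
    and bound: "\<And>j x. j \<le> N \<Longrightarrow> x \<le> t \<Longrightarrow> (cmod (nth_deriv j f x))\<^sup>2 \<le> E * indicat_real A x"
  shows "- ((\<Sum>j\<le>N. \<bar>c j\<bar>) * (E * measure lebesgue A))
    \<le> (\<Sum>j\<le>N. c j * (LINT \<tau>:{..t}|lebesgue. (cmod (nth_deriv j f \<tau>))\<^sup>2))"
proof -
  have "- (\<bar>c j\<bar> * (E * measure lebesgue A)) \<le> c j * (LINT \<tau>:{..t}|lebesgue. (cmod (nth_deriv j f \<tau>))\<^sup>2)"
    if "j \<le> N" for j
  proof -
    let ?I = "LINT \<tau>:{..t}|lebesgue. (cmod (nth_deriv j f \<tau>))\<^sup>2"
    have "?I \<le> (LINT x|lebesgue. E * indicat_real A x)"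
      unfolding set_lebesgue_integral_def
    proof (rule integral_mono')
      show "integrable lebesgue (\<lambda>x. E * indicat_real A x)"
        using A by (auto simp: fmeasurable_def)
      show "indicat_real {..t} x *\<^sub>R (cmod (nth_deriv j f x))\<^sup>2 \<le> E * indicat_real A x" for x
        using bound[OF that, of x] \<open>0 \<le> E\<close> by (auto simp: indicator_def split: if_splits)
      show "0 \<le> E * indicat_real A x" for x using \<open>0 \<le> E\<close> by simp
    qed
    also have "\<dots> = E * measure lebesgue A" by simp
    finally have "?I \<le> E * measure lebesgue A" .
    moreover have "0 \<le> ?I"
      unfolding set_lebesgue_integral_def by (intro Bochner_Integration.integral_nonneg) simp
    ultimately have "\<bar>c j * ?I\<bar> \<le> \<bar>c j\<bar> * (E * measure lebesgue A)"
      unfolding abs_mult by (intro mult_left_mono) auto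
    then show ?thesis by linarith
  qed
  then show ?thesis
    unfolding sum_distrib_right sum_negf[symmetric] by (intro sum_mono) auto
qed

section \<open>Bilinearity of the pairing and the causality argument\<close>

lemma Y_corr_add_left:
  "f \<in> test_functions \<Longrightarrow> g \<in> test_functions \<Longrightarrow> h \<in> test_functions \<Longrightarrow>
    Y (corr (\<lambda>x. f x + g x) h) = Y (corr f h) + Y (corr g h)"
  by (simp add: corr_add_left test_function_smooth distribution_add[OF Y] test_corr)

lemma Y_corr_add_right:
  "f \<in> test_functions \<Longrightarrow> g \<in> test_functions \<Longrightarrow> h \<in> test_functions \<Longrightarrow>
    Y (corr f (\<lambda>x. g x + h x)) = Y (corr f g) + Y (corr f h)"
  by (simp add: corr_add_right test_function_smooth distribution_add[OF Y] test_corr)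

lemma Y_corr_cmult_left:
  "f \<in> test_functions \<Longrightarrow> h \<in> test_functions \<Longrightarrow> Y (corr (\<lambda>x. a * f x) h) = a * Y (corr f h)"
  by (simp add: corr_cmult_left distribution_cmult[OF Y] test_corr)

lemma Y_corr_cmult_right:
  "f \<in> test_functions \<Longrightarrow> h \<in> test_functions \<Longrightarrow> Y (corr f (\<lambda>x. a * h x)) = a * Y (corr f h)"
  by (simp add: corr_cmult_right distribution_cmult[OF Y] test_corr)

text \<open>A linear term in \<open>a\<close> bounded by a quadratic one must vanish. The gap
  \<open>d\<close> makes all derivatives of \<open>f\<close> zero on the closed half line up to 0,
  so the energy there is of order \<open>(cmod a)\<^sup>2\<close>.\<close>

lemma Y_corr_causal:
  assumes f: "f \<in> test_functions" "d > 0" "\<And>x. x \<le> d \<Longrightarrow> f x = 0"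
    and g: "g \<in> test_functions" "\<And>x. 0 \<le> x \<Longrightarrow> g x = 0"
  shows "Y (corr f g) = 0"
proof -
  let ?h = "\<lambda>x. cnj (g x)"
  have h: "?h \<in> test_functions" using g(1) by (rule test_cnj)
  obtain B where B: "B > 0" "deriv_bound N B ?h" by (rule test_function_deriv_bound[OF h])
  obtain r where "supp_in (-r) r ?h" by (rule test_function_supp[OF h])
  then have r: "supp_in (-r) r (nth_deriv j ?h)" for j by (rule supp_in_nth_deriv)
  define K where "K = (\<Sum>j\<le>N. \<bar>c j\<bar>) * (B\<^sup>2 * measure lebesgue {-r..r}) + cmod (Y (corr ?h g))"
  have main: "- K * (cmod a)\<^sup>2 \<le> Re (cnj a * Y (corr f g))" for a
  proof -
    let ?F = "\<lambda>x. f x + a * ?h x"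
    have F: "?F \<in> test_functions" by (intro test_add test_cmult f h)
    have "nth_deriv j f x = 0" if "x \<le> 0" for j x
      using nth_deriv_local[of "{..<d}" f "\<lambda>x. 0" x j] f(2,3) that by auto
    then have "cmod (nth_deriv j ?F x) = cmod a * cmod (nth_deriv j ?h x)" if "x \<le> 0" for j x
      using that
      by (simp add: smooth_add(2)[OF test_function_smooth[OF f(1)] smooth_cmult(1)[OF test_function_smooth[OF h]]]
          smooth_cmult(2)[OF test_function_smooth[OF h]] norm_mult del: complex_mod_cnj)
    moreover have "(cmod a * cmod (nth_deriv j ?h x))\<^sup>2 \<le> (cmod a)\<^sup>2 * B\<^sup>2 * indicat_real {-r..r} x"
      if "j \<le> N" for j x
    proof (cases "x \<in> {-r..r}")
      case True
      then show ?thesis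
        unfolding power_mult_distrib using deriv_boundD[OF B(2) that, of x]
        by (auto intro!: mult_left_mono power_mono)
    qed (use r[of j] in \<open>auto simp: supp_in_def\<close>)
    ultimately have "(cmod (nth_deriv j ?F x))\<^sup>2 \<le> (cmod a)\<^sup>2 * B\<^sup>2 * indicat_real {-r..r} x"
      if "j \<le> N" "x \<le> 0" for j x using that by presburger
    from energy_bound[OF _ _ this]
    have "- ((\<Sum>j\<le>N. \<bar>c j\<bar>) * ((cmod a)\<^sup>2 * B\<^sup>2 * measure lebesgue {-r..r}))
      \<le> (\<Sum>j\<le>N. c j * (LINT \<tau>:{..0}|lebesgue. (cmod (nth_deriv j ?F \<tau>))\<^sup>2))"
      by simp
    \<comment> \<open>Up to 0 only \<open>a * ?h\<close> remains of \<open>?F\<close>, and it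
      vanishes to the right by itself: the cut is smooth.\<close>
    also have "\<dots> \<le> Re (Y (corr ?F (\<lambda>x. cnj (a * ?h x))))"
      by (rule passive_truncated[OF F test_cmult[OF h]]) (use f g in auto)
    also have "(\<lambda>x. cnj (a * ?h x)) = (\<lambda>x. cnj a * g x)" by simp
    also have "Y (corr ?F (\<lambda>x. cnj a * g x)) = cnj a * Y (corr f g) + (cmod a)\<^sup>2 * Y (corr ?h g)"
      by (simp add: Y_corr_cmult_right Y_corr_add_left Y_corr_cmult_left F f(1) h g(1) test_cmult
          algebra_simps) (use complex_norm_square[of a] in simp)
    also have "Re \<dots> \<le> Re (cnj a * Y (corr f g)) + (cmod a)\<^sup>2 * cmod (Y (corr ?h g))"
      using complex_Re_le_cmod[of "Y (corr ?h g)"] by (simp add: mult_left_mono flip: of_real_power)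
    finally show ?thesis by (simp add: K_def algebra_simps)
  qed
  show ?thesis
  proof (rule ccontr)
    assume s: "Y (corr f g) \<noteq> 0"
    let ?s = "Y (corr f g)"
    have K: "K \<ge> 0" unfolding K_def by (intro add_nonneg_nonneg mult_nonneg_nonneg sum_nonneg) auto
    \<comment> \<open>\<open>K * e < 1\<close> is what contradicts the inequality at
      \<open>a = - e * ?s\<close>; the added 1 covers \<open>K = 0\<close>.\<close>
    define e where "e = 1 / (K + 1)"
    have e: "e > 0" "K * e < 1" using K by (auto simp: e_def field_simps)
    have "Re (cnj (- of_real e * ?s) * ?s) = - (e * (cmod ?s)\<^sup>2)"
      unfolding cmod_power2 by (simp add: power2_eq_square algebra_simps)
    then have "- K * (cmod (- of_real e * ?s))\<^sup>2 \<le> - (e * (cmod ?s)\<^sup>2)"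
      using main[of "- of_real e * ?s"] by simp
    then have "e * (cmod ?s)\<^sup>2 \<le> (K * e) * (e * (cmod ?s)\<^sup>2)"
      by (simp add: norm_mult power_mult_distrib power2_eq_square algebra_simps)
    moreover have "e * (cmod ?s)\<^sup>2 > 0" using e s by simp
    ultimately show False using e(2) by (simp add: mult_le_cancel_right1)
  qed
qed

text \<open>\<open>dil j r\<close> vanishes up to \<open>d / 2 ^ j\<close>, so each mollification of
  \<open>g\<close> has value 0, and they converge to \<open>g\<close>.\<close>

lemma Y_causal:
  assumes g: "g \<in> test_functions" "\<And>x. 0 \<le> x \<Longrightarrow> g x = 0"
  shows "Y g = 0"
proof -
  obtain r d where r: "r \<in> test_functions" "supp_in 0 2 r" "integral {0..2} r = 1"
    and d: "d > 0" "\<And>x. x \<le> d \<Longrightarrow> r x = 0"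
    using mollifier_exists[of 0] by metis
  have "Y (corr (dil j r) g) = 0" for j
    by (rule Y_corr_causal[OF dil_test[OF r(1)], of "d / 2 ^ j"])
      (use d g in \<open>auto simp: dil_def field_simps\<close>)
  then show ?thesis
    using distribution_mollify(1)[OF Y r g(1)] by (simp add: LIMSEQ_const_iff)
qed

lemma dist_support_causal: "dist_support Y \<subseteq> {0..}"
proof -
  have "Y f = 0" if "f \<in> test_functions" "fun_support f \<subseteq> {..<0}" for f
  proof (rule Y_causal[OF that(1)])
    have "{x. f x \<noteq> 0} \<subseteq> {..<0}"
      using that(2) unfolding fun_support_def by (rule order_trans[OF closure_subset])
    then show "f x = 0" if "0 \<le> x" for x using that by auto
  qed
  then have "{..<0} \<subseteq> \<Union>{V. open V \<and> (\<forall>f\<in>test_functions. fun_support f \<subseteq> V \<longrightarrow> Y f = 0)}"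
    by (intro Union_upper) auto
  then have "dist_support Y \<subseteq> - {..<0}"
    unfolding dist_support_def by (rule Compl_anti_mono)
  also have "- {..<0::real} = {0..}" by auto
  finally show ?thesis .
qed

end

subsection \<open>Bounds uniform under translation\<close>

lemma corr_deriv_bound:
  assumes f: "f \<in> test_functions" "supp_in a b f" "a \<le> b" and F: "\<And>x. cmod (f x) \<le> F"
    and g: "smooth g" "deriv_bound M G g"
  shows "deriv_bound M (F * G * (b - a)) (corr f g)"
  unfolding deriv_bound_def test_corr_smooth(2)[OF f(1) g(1)]
  using corr_bound[OF smooth_continuous_0[OF test_function_smooth[OF f(1)]] f(2)
      smooth_continuous[OF g(1)] f(3) F deriv_boundD[OF g(2)]] by blast

lemma dil_corr_deriv_bound:
  assumes f: "f \<in> test_functions" "supp_in 0 2 f" and F: "\<And>x. cmod (f x) \<le> F"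
    and g: "smooth g" "deriv_bound M G g"
  shows "deriv_bound M (2 * F * G) (corr (dil j f) g)"
  unfolding deriv_bound_def test_corr_smooth(2)[OF dil_test[OF f(1)] g(1)]
  using dil_corr_bound[OF test_function_smooth[OF f(1)] f(2) smooth_continuous[OF g(1)] F
      deriv_boundD[OF g(2)]] by blast

context passive_distribution
begin

text \<open>Causality removes one of the two mixed terms when the quadratic inequality is
  tested with \<open>f + u * cnj g\<close>, \<open>\<bar>u\<bar> = 1\<close>; the diagonal terms only see \<open>Y\<close> on a fixed
  interval, independently of \<open>a\<close>.\<close>

lemma Y_corr_bound_normalized:
  obtains C M where "C > 0" "\<And>f g a. f \<in> test_functions \<Longrightarrow> g \<in> test_functions \<Longrightarrow>
    supp_in 0 2 f \<Longrightarrow> supp_in (a - 3) (a + 3) g \<Longrightarrow> 6 \<le> a \<Longrightarrow>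
    deriv_bound M 1 f \<Longrightarrow> deriv_bound M 1 g \<Longrightarrow> cmod (Y (corr f g)) \<le> C"
proof -
  \<comment> \<open>Two functions on a common interval of length at most 6 have a correlation
    supported in \<open>{-6..6}\<close>, wherever that interval lies; hence one order
    \<open>M0\<close> serves all \<open>a\<close>.\<close>
  obtain C0 M0 where C0: "C0 > 0" "\<And>f B. f \<in> test_functions \<Longrightarrow> supp_in (-6) 6 f \<Longrightarrow> B > 0 \<Longrightarrow>
    deriv_bound M0 B f \<Longrightarrow> cmod (Y f) \<le> C0 * B"
    using distribution_finite_order[OF Y] by blast
  define M where "M = max M0 N"
  \<comment> \<open>\<open>4\<close> bounds the squared derivatives of a sum of two functions of
    norm at most 1, \<open>8 = 2 + 6\<close> is the length of the two supports, and the last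
    summands are the diagonal terms.\<close>
  define C where "C = (\<Sum>j\<le>N. \<bar>c j\<bar>) * (4 * 8) + C0 * 2 + C0 * 6"
  have "cmod (Y (corr f g)) \<le> C"
    if f: "f \<in> test_functions" "supp_in 0 2 f" "deriv_bound M 1 f"
      and g: "g \<in> test_functions" "supp_in (a - 3) (a + 3) g" "deriv_bound M 1 g" and a: "6 \<le> a" for f g a
  proof -
    note sf = test_function_smooth[OF f(1)] and sg = test_function_smooth[OF g(1)]
    let ?f = "\<lambda>x. cnj (f x)" and ?h = "\<lambda>x. cnj (g x)"
    have f': "?f \<in> test_functions" "supp_in 0 2 ?f" "deriv_bound M 1 ?f"
      using f by (simp_all add: test_cnj deriv_bound_cnj sf) (simp add: supp_in_def)
    have h: "?h \<in> test_functions" "supp_in (a - 3) (a + 3) ?h" "deriv_bound M 1 ?h"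
      using g by (simp_all add: test_cnj deriv_bound_cnj sg) (simp add: supp_in_def)
    have M0: "deriv_bound M0 1 F" if "deriv_bound M 1 F" for F
      by (rule deriv_bound_mono[OF that]) (simp_all add: M_def)
    have "cmod (Y (corr f ?f)) \<le> C0 * 2"
    proof (rule C0(2)[OF test_corr[OF f(1) f'(1)]])
      show "supp_in (-6) 6 (corr f ?f)"
        using corr_supp[OF f(2) f'(2)] by (rule supp_in_mono) auto
      show "deriv_bound M0 2 (corr f ?f)"
        using corr_deriv_bound[OF f(1,2) _ deriv_bound_0D[OF f(3)] test_function_smooth[OF f'(1)] M0[OF f'(3)]]
        by simp
    qed simp
    moreover have "cmod (Y (corr ?h g)) \<le> C0 * 6"
    proof (rule C0(2)[OF test_corr[OF h(1) g(1)]])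
      show "supp_in (-6) 6 (corr ?h g)"
        using corr_supp[OF h(2) g(2)] by (rule supp_in_mono) auto
      show "deriv_bound M0 6 (corr ?h g)"
        using corr_deriv_bound[OF h(1,2) _ deriv_bound_0D[OF h(3)] sg M0[OF g(3)]] by simp
    qed simp
    \<comment> \<open>The correlation is supported in \<open>{-a - 3..5 - a}\<close>, to the left of
      0 as \<open>a \<ge> 6\<close>.\<close>
    moreover have "Y (corr ?h ?f) = 0"
      by (rule Y_causal[OF test_corr[OF h(1) f'(1)]])
        (use corr_supp[OF h(2) f'(2)] a in \<open>auto simp: supp_in_def\<close>)
    moreover have "- ((\<Sum>j\<le>N. \<bar>c j\<bar>) * (4 * 8)) \<le>
      Re (Y (corr f ?f)) + Re (Y (corr ?h g)) + Re (u * Y (corr ?h ?f)) + Re (cnj u * Y (corr f g))"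
      if u: "cmod u = 1" for u
    proof -
      let ?F = "\<lambda>x. f x + u * ?h x" and ?A = "{0..2} \<union> {a - 3..a + 3}"
      have F: "?F \<in> test_functions" by (intro test_add test_cmult f h)
      have suppF: "nth_deriv j ?F x = 0" if "x \<notin> ?A" for j x
        using that nth_deriv_local[of "- ?A" ?F "\<lambda>x. 0" x j] f(2) h(2)
        by (auto simp: supp_in_def)
      have "deriv_bound M (1 + cmod u * 1) ?F"
        by (intro deriv_bound_add deriv_bound_cmult smooth_cmult sf f(3) h(3) test_function_smooth[OF h(1)])
      then have "cmod (nth_deriv j ?F x) \<le> 2" if "j \<le> N" for j x
        using deriv_boundD[of M _ ?F j x] that u by (simp add: M_def)
      then have "(cmod (nth_deriv j ?F x))\<^sup>2 \<le> 2\<^sup>2" if "j \<le> N" for j x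
        using that by (intro power_mono) auto
      then have "(cmod (nth_deriv j ?F x))\<^sup>2 \<le> 4 * indicat_real ?A x" if "j \<le> N" for j x
        using that suppF[of x j] by (cases "x \<in> ?A") (auto simp del: Un_iff)
      then have "- ((\<Sum>j\<le>N. \<bar>c j\<bar>) * (4 * measure lebesgue ?A))
        \<le> (\<Sum>j\<le>N. c j * (LINT \<tau>:{..a + 3}|lebesgue. (cmod (nth_deriv j ?F \<tau>))\<^sup>2))"
        by (intro energy_bound) auto
      \<comment> \<open>\<open>t = a + 3\<close> is to the right of both supports, so nothing is cut
        off.\<close>
      also have "\<dots> \<le> Re (Y (corr ?F (\<lambda>x. cnj (?F x))))"
        by (rule passive_truncated[OF F F]) (use f(2) h(2) a in \<open>auto simp: supp_in_def\<close>)
      also have "(\<lambda>x. cnj (?F x)) = (\<lambda>x. ?f x + cnj u * g x)" by simp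
      also have "Y (corr ?F (\<lambda>x. ?f x + cnj u * g x)) =
          Y (corr f ?f) + u * Y (corr ?h ?f) + cnj u * Y (corr f g) + (u * cnj u) * Y (corr ?h g)"
        by (simp add: Y_corr_cmult_right Y_corr_cmult_left Y_corr_add_left Y_corr_add_right
            F f(1) f'(1) h(1) g(1) test_cmult algebra_simps)
      also have "u * cnj u = 1"
        using u complex_norm_square[of u] by simp
      finally have *: "- ((\<Sum>j\<le>N. \<bar>c j\<bar>) * (4 * measure lebesgue ?A)) \<le>
        Re (Y (corr f ?f)) + Re (Y (corr ?h g)) + Re (u * Y (corr ?h ?f)) + Re (cnj u * Y (corr f g))"
        by simp
      have "measure lebesgue ?A \<le> measure lebesgue {0..2::real} + measure lebesgue {a - 3..a + 3}"
        by (rule measure_Un_le) auto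
      then have "(\<Sum>j\<le>N. \<bar>c j\<bar>) * (4 * measure lebesgue ?A) \<le> (\<Sum>j\<le>N. \<bar>c j\<bar>) * (4 * 8)"
        by (intro mult_left_mono) (auto intro: sum_nonneg)
      with * show ?thesis by linarith
    qed
    ultimately have *: "- C \<le> Re (cnj u * Y (corr f g))" if "cmod u = 1" for u
      using that complex_Re_le_cmod[of "Y (corr f ?f)"] complex_Re_le_cmod[of "Y (corr ?h g)"]
      unfolding C_def by fastforce
    show ?thesis
    proof (cases "Y (corr f g) = 0")
      case True
      have "0 \<le> C" unfolding C_def using C0(1) by (intro add_nonneg_nonneg mult_nonneg_nonneg sum_nonneg) auto
      with True show ?thesis by simp
    next
      case False
      let ?s = "Y (corr f g)"
      \<comment> \<open>Among all \<open>u\<close> of modulus 1, \<open>- sgn ?s\<close> rotates the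
        mixed term onto the negative real axis.\<close>
      have "cnj (- sgn ?s) * ?s = - of_real (cmod ?s)"
        using False complex_norm_square[of ?s]
        by (simp add: sgn_eq field_simps power2_eq_square)
      then have "Re (cnj (- sgn ?s) * ?s) = - cmod ?s" by simp
      then show ?thesis using *[of "- sgn ?s"] False by (simp add: norm_sgn)
    qed
  qed
  moreover have "C > 0" unfolding C_def using C0(1)
    by (intro add_nonneg_pos add_nonneg_nonneg mult_nonneg_nonneg sum_nonneg) auto
  ultimately show thesis using that[of C M] by blast
qed

lemma Y_corr_bound:
  obtains C M where "C > 0" "\<And>f g a A B. f \<in> test_functions \<Longrightarrow> g \<in> test_functions \<Longrightarrow>
    supp_in 0 2 f \<Longrightarrow> supp_in (a - 3) (a + 3) g \<Longrightarrow> 6 \<le> a \<Longrightarrow> 0 < A \<Longrightarrow> 0 < B \<Longrightarrow>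
    deriv_bound M A f \<Longrightarrow> deriv_bound M B g \<Longrightarrow> cmod (Y (corr f g)) \<le> C * A * B"
proof -
  obtain C M where C: "C > 0" "\<And>f g a. f \<in> test_functions \<Longrightarrow> g \<in> test_functions \<Longrightarrow>
    supp_in 0 2 f \<Longrightarrow> supp_in (a - 3) (a + 3) g \<Longrightarrow> 6 \<le> a \<Longrightarrow>
    deriv_bound M 1 f \<Longrightarrow> deriv_bound M 1 g \<Longrightarrow> cmod (Y (corr f g)) \<le> C"
    using Y_corr_bound_normalized by blast
  have "cmod (Y (corr f g)) \<le> C * A * B"
    if f: "f \<in> test_functions" "supp_in 0 2 f" "deriv_bound M A f"
      and g: "g \<in> test_functions" "supp_in (a - 3) (a + 3) g" "deriv_bound M B g"
      and a: "6 \<le> a" and AB: "A > 0" "B > 0" for f g a A B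
  proof -
    let ?f = "\<lambda>x. inverse (of_real A) * f x" and ?g = "\<lambda>x. inverse (of_real B) * g x"
    have "cmod (Y (corr ?f ?g)) \<le> C"
    proof (rule C(2)[OF _ _ _ _ a])
      show "deriv_bound M 1 ?f"
        using deriv_bound_cmult[OF test_function_smooth[OF f(1)] f(3), of "inverse (of_real A)"] AB
        by (simp add: norm_inverse)
      show "deriv_bound M 1 ?g"
        using deriv_bound_cmult[OF test_function_smooth[OF g(1)] g(3), of "inverse (of_real B)"] AB
        by (simp add: norm_inverse)
      show "supp_in 0 2 ?f" "supp_in (a - 3) (a + 3) ?g"
        using f(2) g(2) by (simp_all add: supp_in_def)
    qed (intro test_cmult f g)+
    moreover have "cmod (Y (corr ?f ?g)) = inverse A * (inverse B * cmod (Y (corr f g)))"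
      using AB by (simp add: Y_corr_cmult_left Y_corr_cmult_right f g test_cmult norm_mult norm_inverse)
    ultimately have "inverse A * (inverse B * cmod (Y (corr f g))) \<le> C" by linarith
    then show ?thesis using AB by (simp add: field_simps)
  qed
  with C(1) show thesis using that[of C M] by blast
qed

text \<open>Only the outer kernel is measured in the norm of order \<open>M\<close> and costs
  \<open>2 ^ (j * Suc M)\<close>; the inner one acts on \<open>g\<close> with a factor independent
  of \<open>j\<close>. \<open>M\<close> precedes \<open>p\<close> and \<open>q\<close> because the
  kernels will be chosen with moments depending on \<open>M\<close>.\<close>

lemma Y_corr_dil_bound:
  obtains M where "\<And>p q. p \<in> test_functions \<Longrightarrow> supp_in 0 2 p \<Longrightarrow> q \<in> test_functions \<Longrightarrow>
    supp_in 0 2 q \<Longrightarrow> \<exists>C>0. \<forall>j a g B. g \<in> test_functions \<longrightarrow> supp_in (a - 1) (a + 1) g \<longrightarrow> 6 \<le> a \<longrightarrow>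
      0 < B \<longrightarrow> deriv_bound M B g \<longrightarrow>
      cmod (Y (corr (dil j p) (corr (dil j q) g))) \<le> C * 2 ^ (j * Suc M) * B"
proof -
  obtain C M where C: "C > 0" "\<And>f g a A B. f \<in> test_functions \<Longrightarrow> g \<in> test_functions \<Longrightarrow>
    supp_in 0 2 f \<Longrightarrow> supp_in (a - 3) (a + 3) g \<Longrightarrow> 6 \<le> a \<Longrightarrow> 0 < A \<Longrightarrow> 0 < B \<Longrightarrow>
    deriv_bound M A f \<Longrightarrow> deriv_bound M B g \<Longrightarrow> cmod (Y (corr f g)) \<le> C * A * B"
    using Y_corr_bound by blast
  show thesis
  proof (rule that[of M])
    fix p q assume p: "p \<in> test_functions" "supp_in 0 2 p" and q: "q \<in> test_functions" "supp_in 0 2 q"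
    obtain P where P: "P > 0" "deriv_bound M P p" using test_function_deriv_bound[OF p(1)] by blast
    obtain Q where Q: "Q > 0" "\<And>x. cmod (q x) \<le> Q"
      using test_function_deriv_bound[OF q(1), of 0] deriv_bound_0D by metis
    have "cmod (Y (corr (dil j p) (corr (dil j q) g))) \<le> (C * P * (2 * Q)) * 2 ^ (j * Suc M) * B"
      if g: "g \<in> test_functions" "supp_in (a - 1) (a + 1) g" "deriv_bound M B g" and a: "6 \<le> a"
        and B: "0 < B" for j a g B
    proof -
      have "cmod (Y (corr (dil j p) (corr (dil j q) g))) \<le> C * (2 ^ (j * Suc M) * P) * (2 * Q * B)"
      proof (rule C(2)[OF _ _ _ _ a])
        \<comment> \<open>A kernel on \<open>[0, 2]\<close> moves the left end of the support of
          \<open>g\<close> by at most 2, hence the radius 3.\<close>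
        show "supp_in (a - 3) (a + 3) (corr (dil j q) g)"
          by (rule supp_in_mono[OF corr_supp[OF dil_supp_0[OF q(2)] g(2)]]) auto
        show "deriv_bound M (2 ^ (j * Suc M) * P) (dil j p)"
          using P by (intro dil_deriv_bound test_function_smooth p) auto
        show "deriv_bound M (2 * Q * B) (corr (dil j q) g)"
          by (intro dil_corr_deriv_bound q Q test_function_smooth g)
      qed (use P(1) Q(1) B in \<open>auto intro: dil_test test_corr dil_supp_0 p q g\<close>)
      then show ?thesis by (simp add: algebra_simps)
    qed
    moreover have "C * P * (2 * Q) > 0" using C(1) P(1) Q(1) by simp
    ultimately show "\<exists>C>0. \<forall>j a g B. g \<in> test_functions \<longrightarrow> supp_in (a - 1) (a + 1) g \<longrightarrow> 6 \<le> a \<longrightarrow>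
      0 < B \<longrightarrow> deriv_bound M B g \<longrightarrow>
      cmod (Y (corr (dil j p) (corr (dil j q) g))) \<le> C * 2 ^ (j * Suc M) * B"
      by blast
  qed
qed

text \<open>Littlewood--Paley style telescoping over dyadic mollifications: the increments lose
  \<open>2 ^ (j * Suc M)\<close> but gain \<open>2 ^ (- j * (M + 2))\<close> from the vanishing moments.\<close>

lemma Y_bound_far:
  obtains C M where "C > 0" "\<And>g a B. g \<in> test_functions \<Longrightarrow> supp_in (a - 1) (a + 1) g \<Longrightarrow>
    6 \<le> a \<Longrightarrow> 0 < B \<Longrightarrow> deriv_bound M B g \<Longrightarrow> cmod (Y g) \<le> C * B"
proof -
  obtain M where M: "\<And>p q. p \<in> test_functions \<Longrightarrow> supp_in 0 2 p \<Longrightarrow> q \<in> test_functions \<Longrightarrow>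
    supp_in 0 2 q \<Longrightarrow> \<exists>C>0. \<forall>j a g B. g \<in> test_functions \<longrightarrow> supp_in (a - 1) (a + 1) g \<longrightarrow> 6 \<le> a \<longrightarrow>
      0 < B \<longrightarrow> deriv_bound M B g \<longrightarrow>
      cmod (Y (corr (dil j p) (corr (dil j q) g))) \<le> C * 2 ^ (j * Suc M) * B"
    using Y_corr_dil_bound by blast
  define n where "n = Suc (Suc M)"
  obtain r z where r: "r \<in> test_functions" "supp_in 0 2 r" "integral {0..2} r = 1"
    and z: "z \<in> test_functions" "supp_in 0 2 z" and rz: "\<And>x. dil 1 r x - r x = nth_deriv n z x"
    unfolding n_def using mollifier_exists[of "Suc M"] by metis
  note sz = test_function_smooth[OF z(1)]
  note dr = dil_test[OF r(1)] and dz = dil_test[OF z(1)]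
  have r1: "dil 1 r \<in> test_functions" "supp_in 0 2 (dil 1 r)"
    using r by (auto intro: dil_test dil_supp_0)
  obtain C0 where C0: "C0 > 0" "\<And>j a g B. g \<in> test_functions \<Longrightarrow> supp_in (a - 1) (a + 1) g \<Longrightarrow> 6 \<le> a \<Longrightarrow>
      0 < B \<Longrightarrow> deriv_bound M B g \<Longrightarrow>
      cmod (Y (corr (dil j r) (corr (dil j r) g))) \<le> C0 * 2 ^ (j * Suc M) * B"
    using M[OF r(1,2) r(1,2)] by blast
  obtain C1 where C1: "C1 > 0" "\<And>j a g B. g \<in> test_functions \<Longrightarrow> supp_in (a - 1) (a + 1) g \<Longrightarrow> 6 \<le> a \<Longrightarrow>
      0 < B \<Longrightarrow> deriv_bound M B g \<Longrightarrow>
      cmod (Y (corr (dil j (dil 1 r)) (corr (dil j z) g))) \<le> C1 * 2 ^ (j * Suc M) * B"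
    using M[OF r1 z] by blast
  obtain C2 where C2: "C2 > 0" "\<And>j a g B. g \<in> test_functions \<Longrightarrow> supp_in (a - 1) (a + 1) g \<Longrightarrow> 6 \<le> a \<Longrightarrow>
      0 < B \<Longrightarrow> deriv_bound M B g \<Longrightarrow>
      cmod (Y (corr (dil j z) (corr (dil j r) g))) \<le> C2 * 2 ^ (j * Suc M) * B"
    using M[OF z r(1,2)] by blast
  have dil_dil: "dil j (dil 1 r) = dil (Suc j) r" for j
    by (simp add: dil_def fun_eq_iff mult.assoc mult.left_commute)
  \<comment> \<open>The sign comes from \<open>n\<close> integrations by parts, the power from
    rewriting the rescaled \<open>n\<close>th derivative of \<open>z\<close> as the
    \<open>n\<close>th derivative of \<open>dil j z\<close>.\<close>
  define q :: "nat \<Rightarrow> complex" where "q j = (-1) ^ n * inverse (2 ^ (j * n))" for j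
  have q_norm: "cmod (q j) * 2 ^ (j * Suc M) = inverse (2 ^ j)" for j
  proof -
    have "(2::real) ^ (j * n) = 2 ^ (j * Suc M) * 2 ^ j"
      unfolding power_add[symmetric] n_def by (simp add: algebra_simps)
    moreover have "cmod (q j) = inverse (2 ^ (j * n))"
      unfolding q_def norm_mult norm_power norm_inverse by simp
    ultimately show ?thesis by (simp add: field_simps)
  qed
  have corr_incr: "corr (\<lambda>x. dil (Suc j) r x - dil j r x) h = (\<lambda>x. q j * corr (dil j z) (nth_deriv n h) x)"
    if "smooth h" for j h
  proof -
    have "dil (Suc j) r x - dil j r x = inverse (2 ^ (j * n)) * nth_deriv n (dil j z) x" for x
    proof -
      have "dil (Suc j) r x - dil j r x = 2 ^ j * (dil 1 r (2 ^ j * x) - r (2 ^ j * x))"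
        unfolding dil_dil[symmetric] by (simp add: dil_def algebra_simps)
      also have "\<dots> = inverse (2 ^ (j * n)) * nth_deriv n (dil j z) x"
        unfolding rz dil_smooth(2)[OF sz] by (simp add: power_add)
      finally show ?thesis .
    qed
    then have "(\<lambda>x. dil (Suc j) r x - dil j r x) = (\<lambda>x. inverse (2 ^ (j * n)) * nth_deriv n (dil j z) x)"
      by blast
    then show ?thesis
      by (simp add: corr_cmult_left corr_nth_deriv[OF dz that] q_def fun_eq_iff)
  qed
  show thesis
  \<comment> \<open>\<open>n\<close> derivatives are moved to \<open>g\<close> before its norm of
    order \<open>M\<close> is taken; the factor 2 is the sum of the geometric series.\<close>
  proof (rule that[of "C0 + (C1 + C2) * 2" "M + n"])
    fix g a B assume g: "g \<in> test_functions" "supp_in (a - 1) (a + 1) g" "deriv_bound (M + n) B g"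
      and a: "6 \<le> (a::real)" and B: "0 < (B::real)"
    note sg = test_function_smooth[OF g(1)]
    have gM: "deriv_bound M B g" using g(3) by (rule deriv_bound_mono) auto
    have gn: "nth_deriv n g \<in> test_functions" "supp_in (a - 1) (a + 1) (nth_deriv n g)"
      "deriv_bound M B (nth_deriv n g)"
      using g(3) by (auto intro: test_nth_deriv supp_in_nth_deriv g
          simp: deriv_bound_def smooth_nth_deriv(2)[OF sg])
    define A where "A j = Y (corr (dil j r) (corr (dil j r) g))" for j
    have incr: "cmod (A (Suc j) - A j) \<le> (C1 + C2) * B * (1 / 2) ^ j" for j
    proof -
      let ?d = "\<lambda>x. dil (Suc j) r x - dil j r x"
      have d: "?d \<in> test_functions" by (intro test_diff dr)
      \<comment> \<open>The two kernels are exchanged one after the other.\<close>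
      have "A (Suc j) - A j = (Y (corr (dil (Suc j) r) (corr (dil (Suc j) r) g)) -
            Y (corr (dil (Suc j) r) (corr (dil j r) g))) +
          (Y (corr (dil (Suc j) r) (corr (dil j r) g)) - Y (corr (dil j r) (corr (dil j r) g)))"
        by (simp add: A_def)
      also have "Y (corr (dil (Suc j) r) (corr (dil (Suc j) r) g)) -
            Y (corr (dil (Suc j) r) (corr (dil j r) g)) = Y (corr (dil (Suc j) r) (corr ?d g))"
        by (simp add: corr_diff_left dr sg corr_diff_right test_corr_smooth test_corr g distribution_diff[OF Y])
      also have "Y (corr (dil (Suc j) r) (corr (dil j r) g)) - Y (corr (dil j r) (corr (dil j r) g))
          = Y (corr ?d (corr (dil j r) g))"
        by (simp add: corr_diff_left dr sg test_corr_smooth test_corr g distribution_diff[OF Y])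
      also have "Y (corr (dil (Suc j) r) (corr ?d g)) =
          q j * Y (corr (dil j (dil 1 r)) (corr (dil j z) (nth_deriv n g)))"
        unfolding corr_incr[OF sg] dil_dil by (intro Y_corr_cmult_right dr test_corr dz gn)
      also have "Y (corr ?d (corr (dil j r) g)) =
          q j * Y (corr (dil j z) (corr (dil j r) (nth_deriv n g)))"
        unfolding corr_incr[OF test_corr_smooth(1)[OF dr sg]] test_corr_smooth(2)[OF dr sg]
        by (intro distribution_cmult[OF Y] test_corr dr dz gn)
      also have "cmod (q j * Y (corr (dil j (dil 1 r)) (corr (dil j z) (nth_deriv n g))) +
          q j * Y (corr (dil j z) (corr (dil j r) (nth_deriv n g))))
        \<le> cmod (q j) * (C1 * 2 ^ (j * Suc M) * B) + cmod (q j) * (C2 * 2 ^ (j * Suc M) * B)"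
        using C1(2)[OF gn(1,2) a B gn(3), of j] C2(2)[OF gn(1,2) a B gn(3), of j]
        by (intro norm_triangle_mono) (auto simp: norm_mult intro: mult_left_mono)
      also have "\<dots> = (C1 + C2) * B * (cmod (q j) * 2 ^ (j * Suc M))"
        by (simp add: algebra_simps)
      also have "\<dots> = (C1 + C2) * B * (1 / 2) ^ j"
        unfolding q_norm by (simp add: power_one_over inverse_eq_divide)
      finally show ?thesis .
    qed
    \<comment> \<open>The partial sum \<open>2 - 2 * (1 / 2) ^ j\<close> is kept exact so that the
      induction closes.\<close>
    have "cmod (A j) \<le> C0 * B + (C1 + C2) * B * (2 - 2 * (1 / 2) ^ j)" for j
    proof (induction j)
      case 0
      then show ?case using C0(2)[OF g(1,2) a B gM, of 0] by (simp add: A_def)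
    next
      case (Suc j)
      have "cmod (A (Suc j)) \<le> cmod (A j) + cmod (A (Suc j) - A j)"
        using norm_triangle_ineq[of "A j" "A (Suc j) - A j"] by simp
      with Suc incr[of j] show ?case by (simp add: algebra_simps)
    qed
    moreover have "(C1 + C2) * B * (2 - 2 * (1 / 2) ^ j) \<le> (C1 + C2) * B * 2" for j
      using C1(1) C2(1) B by (intro mult_left_mono) auto
    ultimately have "cmod (A j) \<le> (C0 + (C1 + C2) * 2) * B" for j
      by (smt (verit) distrib_right mult.assoc mult.commute)
    moreover have "(\<lambda>j. cmod (A j)) \<longlonglongrightarrow> cmod (Y g)"
      unfolding A_def by (intro tendsto_norm distribution_mollify(2)[OF Y r g(1)])
    ultimately show "cmod (Y g) \<le> (C0 + (C1 + C2) * 2) * B"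
      by (intro LIMSEQ_le_const2) auto
  qed (use C0(1) C1(1) C2(1) in simp)
qed

text \<open>For \<open>n \<ge> 8\<close> the centre \<open>n - 2\<close> is at least 6; the
  remaining intervals lie in \<open>{-3..7}\<close>, where the finite order of \<open>Y\<close>
  applies. The indexing is that of the partition below.\<close>

lemma Y_bound_uniform:
  obtains C M where "C > 0" "\<And>g n B. g \<in> test_functions \<Longrightarrow> supp_in (real n - 3) (real n - 1) g \<Longrightarrow>
    0 < B \<Longrightarrow> deriv_bound M B g \<Longrightarrow> cmod (Y g) \<le> C * B"
proof -
  obtain C0 M0 where C0: "C0 > 0" "\<And>g a B. g \<in> test_functions \<Longrightarrow> supp_in (a - 1) (a + 1) g \<Longrightarrow>
    6 \<le> a \<Longrightarrow> 0 < B \<Longrightarrow> deriv_bound M0 B g \<Longrightarrow> cmod (Y g) \<le> C0 * B"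
    using Y_bound_far by blast
  obtain C1 M1 where C1: "C1 > 0" "\<And>f B. f \<in> test_functions \<Longrightarrow> supp_in (-3) 7 f \<Longrightarrow> B > 0 \<Longrightarrow>
    deriv_bound M1 B f \<Longrightarrow> cmod (Y f) \<le> C1 * B"
    using distribution_finite_order[OF Y] by blast
  show thesis
  proof (rule that[of "C0 + C1" "max M0 M1"])
    fix g n B assume g: "g \<in> test_functions" "supp_in (real n - 3) (real n - 1) g"
      and B: "0 < B" and bound: "deriv_bound (max M0 M1) B g"
    show "cmod (Y g) \<le> (C0 + C1) * B"
    proof (cases "n \<ge> 8")
      case True
      have "deriv_bound M0 B g" using bound by (rule deriv_bound_mono) auto
      moreover have "supp_in (real n - 2 - 1) (real n - 2 + 1) g" using g(2) by simp
      ultimately have "cmod (Y g) \<le> C0 * B"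
        using C0(2)[OF g(1), of "real n - 2" B] True B by simp
      then show ?thesis using C1(1) B by (simp add: distrib_right add_increasing2)
    next
      case False
      have "deriv_bound M1 B g" using bound by (rule deriv_bound_mono) auto
      moreover have "supp_in (-3) 7 g" using g(2) by (rule supp_in_mono) (use False in auto)
      ultimately have "cmod (Y g) \<le> C1 * B" using C1(2)[OF g(1)] B by blast
      then show ?thesis using C0(1) B by (simp add: distrib_right add_increasing)
    qed
  qed (use C0(1) C1(1) in simp)
qed

end

subsection \<open>Temperedness\<close>

lemma test_function_schwartz:
  assumes f: "f \<in> test_functions"
  shows "f \<in> schwartz_functions"
proof -
  obtain r where r: "supp_in (-r) r f" by (rule test_function_supp[OF f])
  have "bounded (range (\<lambda>x. (x ^ j) *\<^sub>R nth_deriv k f x))" for j k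
  proof (rule continuous_supp_bounded)
    show "continuous_on UNIV (\<lambda>x. (x ^ j) *\<^sub>R nth_deriv k f x)"
      by (intro continuous_intros smooth_continuous test_function_smooth f)
    show "supp_in (-r) r (\<lambda>x. (x ^ j) *\<^sub>R nth_deriv k f x)"
      using supp_in_nth_deriv[OF r, of k] by (simp add: supp_in_def)
  qed
  then show ?thesis
    using test_function_smooth[OF f] by (simp add: schwartz_functions_def)
qed

text \<open>The weight joins the Schwartz seminorms with powers 0 and 2; it makes the contributions
  of unit translates summable.\<close>

definition decay_bound :: "nat \<Rightarrow> real \<Rightarrow> (real \<Rightarrow> complex) \<Rightarrow> bool" where
  "decay_bound M B f \<longleftrightarrow> (\<forall>k\<le>M. \<forall>x. (1 + x\<^sup>2) * cmod (nth_deriv k f x) \<le> B)"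

lemma schwartz_decay_bound:
  assumes "f \<in> schwartz_functions"
  obtains B where "B > 0" "decay_bound M B f"
proof -
  have "\<exists>B>0. \<forall>x. (1 + x\<^sup>2) * cmod (nth_deriv k f x) \<le> B" for k
  proof -
    have b: "bounded (range (\<lambda>x. (x ^ j) *\<^sub>R nth_deriv k f x))" for j
      using assms by (simp add: schwartz_functions_def)
    obtain B0 where B0: "B0 > 0" "\<And>x. cmod (nth_deriv k f x) \<le> B0"
      using b[of 0] unfolding bounded_pos by auto
    obtain B2 where B2: "B2 > 0" "\<And>x. x\<^sup>2 * cmod (nth_deriv k f x) \<le> B2"
      using b[of 2] unfolding bounded_pos by auto
    have "(1 + x\<^sup>2) * cmod (nth_deriv k f x) \<le> B0 + B2" for x
      using B0(2)[of x] B2(2)[of x] by (simp add: distrib_right)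
    then show ?thesis using B0(1) B2(1) by (intro exI[of _ "B0 + B2"]) auto
  qed
  then obtain B where B: "\<And>k. B k > 0" "\<And>k x. (1 + x\<^sup>2) * cmod (nth_deriv k f x) \<le> B k"
    by metis
  have "decay_bound M (sum B {..M}) f"
    unfolding decay_bound_def
  proof (intro allI impI)
    fix k x assume "k \<le> M"
    then have "B k \<le> sum B {..M}"
      using B(1) by (intro member_le_sum) (auto intro: less_imp_le)
    with B(2)[of x k] show "(1 + x\<^sup>2) * cmod (nth_deriv k f x) \<le> sum B {..M}" by linarith
  qed
  moreover have "sum B {..M} > 0" using B(1) by (intro sum_pos) auto
  ultimately show thesis using that by blast
qed

lemma tendsto_schwartz_decay_bound:
  assumes "tendsto_schwartz \<Phi> \<phi>" and "e > 0"
  shows "\<forall>\<^sub>F n in sequentially. decay_bound M e (\<lambda>x. \<Phi> n x - \<phi> x)"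
proof -
  have \<Phi>: "smooth (\<Phi> n)" "smooth \<phi>" for n
    using assms(1) by (auto simp: tendsto_schwartz_def schwartz_functions_def)
  have "\<forall>\<^sub>F n in sequentially. \<forall>x. (1 + x\<^sup>2) * cmod (nth_deriv k (\<lambda>x. \<Phi> n x - \<phi> x) x) \<le> e" for k
  proof -
    have u: "\<forall>\<^sub>F n in sequentially. \<forall>x\<in>UNIV. dist ((x ^ j) *\<^sub>R nth_deriv k (\<Phi> n) x) ((x ^ j) *\<^sub>R nth_deriv k \<phi> x) < e / 2" for j
      using assms by (intro uniform_limitD) (auto simp: tendsto_schwartz_def)
    show ?thesis
      using u[of 0] u[of 2]
    proof eventually_elim
      case (elim n)
      show ?case
      proof
        fix x
        have "cmod (nth_deriv k (\<Phi> n) x - nth_deriv k \<phi> x) < e / 2"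
          using elim(1) by (simp add: dist_norm)
        moreover have "x\<^sup>2 * cmod (nth_deriv k (\<Phi> n) x - nth_deriv k \<phi> x) < e / 2"
        proof -
          have "cmod (x\<^sup>2 *\<^sub>R nth_deriv k (\<Phi> n) x - x\<^sup>2 *\<^sub>R nth_deriv k \<phi> x) < e / 2"
            using elim(2) by (simp add: dist_norm)
          then show ?thesis
            unfolding scaleR_diff_right[symmetric] norm_scaleR by simp
        qed
        ultimately show "(1 + x\<^sup>2) * cmod (nth_deriv k (\<lambda>x. \<Phi> n x - \<phi> x) x) \<le> e"
          by (simp add: smooth_diff(2)[OF \<Phi>] distrib_right)
      qed
    qed
  qed
  then have "\<forall>\<^sub>F n in sequentially. \<forall>k\<in>{..M}. \<forall>x. (1 + x\<^sup>2) * cmod (nth_deriv k (\<lambda>x. \<Phi> n x - \<phi> x) x) \<le> e"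
    by (intro eventually_ball_finite) auto
  then show ?thesis by (rule eventually_mono) (simp add: decay_bound_def)
qed

section \<open>Partition of unity on a half line\<close>

lemma supp_in_shift:
  assumes "supp_in a b f"
  shows "supp_in (c + a) (c + b) (\<lambda>x. f (x - c))"
  unfolding supp_in_def
proof (intro allI impI)
  fix x assume "x \<notin> {c + a..c + b}"
  then have "x - c \<notin> {a..b}" by auto
  with assms show "f (x - c) = 0" unfolding supp_in_def by blast
qed

text \<open>With \<open>h\<close> the difference of a step and its unit translate, the sum
  telescopes to \<open>s x - s (x - real m)\<close>, which is 1 between the first and the last
  step.\<close>

lemma smooth_partition_exists:
  obtains h where "smooth h" "supp_in (-3) (-1) h"
    "\<And>x m. -2 \<le> x \<Longrightarrow> x \<le> real m - 3 \<Longrightarrow> (\<Sum>n<m. h (x - real n)) = 1"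
proof -
  obtain s where s: "smooth s" "\<And>x. x \<le> -3 \<Longrightarrow> s x = 0" "\<And>x. -2 \<le> x \<Longrightarrow> s x = 1"
    by (rule smooth_step_exists[of "-3" "-2"]) (simp, blast)
  let ?h = "\<lambda>x. s x - s (1 * x + - 1)"
  have "smooth ?h" by (intro smooth_diff smooth_affine s(1))
  moreover have "supp_in (-3) (-1) ?h" using s(2,3) by (auto simp: supp_in_def)
  moreover have "(\<Sum>n<m. ?h (x - real n)) = 1" if "-2 \<le> x" "x \<le> real m - 3" for x m
  proof -
    have "(\<Sum>n<m. ?h (x - real n)) = (\<Sum>n<m. s (x - real n) - s (x - real (Suc n)))"
      by (simp add: algebra_simps)
    also have "\<dots> = s (x - real 0) - s (x - real m)" by (rule sum_lessThan_telescope')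
    finally show ?thesis using that s(2)[of "x - real m"] s(3)[of x] by simp
  qed
  ultimately show thesis using that by blast
qed

context passive_distribution
begin

text \<open>The translate of \<open>h\<close> confines \<open>f\<close> to an interval near
  \<open>n\<close>, where the weight in \<open>decay_bound\<close> becomes a factor of size
  \<open>1 / (n + 1)^2\<close>.\<close>

lemma Y_piece_bound:
  assumes h: "smooth h" "supp_in (-3) (-1) h"
  obtains C M where "C > 0" "\<And>f n B. smooth f \<Longrightarrow> B > 0 \<Longrightarrow> decay_bound M B f \<Longrightarrow>
    cmod (Y (\<lambda>x. f x * h (x - real n))) \<le> C * B * (1 / (real n + 1)\<^sup>2)"
proof -
  obtain C M where C: "C > 0" "\<And>g n B. g \<in> test_functions \<Longrightarrow> supp_in (real n - 3) (real n - 1) g \<Longrightarrow>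
    0 < B \<Longrightarrow> deriv_bound M B g \<Longrightarrow> cmod (Y g) \<le> C * B"
    using Y_bound_uniform by blast
  obtain H where H: "H > 0" "deriv_bound M H h"
    by (rule test_function_deriv_bound[OF test_functionI[OF h]])
  have "cmod (Y (\<lambda>x. f x * h (x - real n))) \<le> C * (2 ^ M * (17 * B / (real n + 1)\<^sup>2 * H))"
    if f: "smooth f" "decay_bound M B f" and B: "B > 0" for f n B
  proof -
    let ?h = "\<lambda>x. h (1 * x + - real n)"
    let ?E = "17 * B / (real n + 1)\<^sup>2"
    have sh: "smooth ?h" by (rule smooth_affine(1)[OF h(1)])
    have suppn: "supp_in (real n - 3) (real n - 1) ?h" using supp_in_shift[OF h(2), of "real n"] by simp
    have f_le: "cmod (nth_deriv k f x) \<le> ?E" if "k \<le> M" "x \<in> {real n - 3..real n - 1}" for k x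
    proof -
      have "(real n + 1)\<^sup>2 \<le> (x + 4)\<^sup>2" using that by (intro power_mono) auto
      \<comment> \<open>Cauchy-Schwarz for \<open>x * 1 + 1 * 4\<close>, with
        \<open>17 = 1 + 4 ^ 2\<close>; the two sides differ by \<open>(4 * x - 1)^2\<close>.\<close>
      also have "\<dots> \<le> 17 * (1 + x\<^sup>2)"
        using zero_le_power2[of "4 * x - 1"] by (simp add: power2_eq_square algebra_simps)
      finally have "(real n + 1)\<^sup>2 * cmod (nth_deriv k f x) \<le> 17 * (1 + x\<^sup>2) * cmod (nth_deriv k f x)"
        by (intro mult_right_mono) auto
      moreover have "(1 + x\<^sup>2) * cmod (nth_deriv k f x) \<le> B"
        using f(2) that(1) by (simp add: decay_bound_def)
      ultimately have "(real n + 1)\<^sup>2 * cmod (nth_deriv k f x) \<le> 17 * B"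
        unfolding mult.assoc by linarith
      then show ?thesis by (simp add: field_simps)
    qed
    have E: "?E > 0" using B by simp
    \<comment> \<open>\<open>2 ^ M\<close> bounds the sum of the binomial coefficients in the
      Leibniz rule.\<close>
    have "deriv_bound M (2 ^ M * (?E * H)) (\<lambda>x. f x * ?h x)"
      unfolding deriv_bound_def
    proof (intro allI impI)
      fix k x assume k: "k \<le> M"
      have term_le: "cmod (of_nat (k choose i) * (nth_deriv i f x * nth_deriv (k - i) ?h x))
          \<le> real (k choose i) * (?E * H)" if "i \<le> k" for i
      proof (cases "x \<in> {real n - 3..real n - 1}")
        case True
        have "cmod (nth_deriv (k - i) ?h x) \<le> H"
          unfolding smooth_affine(2)[OF h(1)] using deriv_boundD[OF H(2)] k by simp
        then show ?thesis
          unfolding norm_mult using f_le[OF _ True, of i] that k E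
          by (intro mult_mono) auto
      next
        case False
        then have "nth_deriv (k - i) ?h x = 0"
          using supp_in_nth_deriv[OF suppn] unfolding supp_in_def by blast
        then show ?thesis using B H(1) by simp
      qed
      have "cmod (nth_deriv k (\<lambda>x. f x * ?h x) x) \<le> (\<Sum>i\<le>k. real (k choose i) * (?E * H))"
        unfolding smooth_mult(2)[OF f(1) sh] by (rule sum_norm_le) (rule term_le, simp)
      also have "\<dots> = 2 ^ k * (?E * H)"
        unfolding sum_distrib_right[symmetric] of_nat_sum[symmetric] choose_row_sum by simp
      also have "\<dots> \<le> 2 ^ M * (?E * H)"
        using k B H(1) by (intro mult_right_mono power_increasing) auto
      finally show "cmod (nth_deriv k (\<lambda>x. f x * ?h x) x) \<le> 2 ^ M * (?E * H)" .
    qed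
    moreover have "smooth (\<lambda>x. f x * ?h x)" by (rule smooth_mult(1)[OF f(1) sh])
    moreover have supp: "supp_in (real n - 3) (real n - 1) (\<lambda>x. f x * ?h x)"
      using suppn by (simp add: supp_in_def)
    ultimately have "cmod (Y (\<lambda>x. f x * ?h x)) \<le> C * (2 ^ M * (?E * H))"
      using B H(1) by (intro C(2) test_functionI) auto
    then show ?thesis by simp
  qed
  then have "cmod (Y (\<lambda>x. f x * h (x - real n))) \<le> (C * 2 ^ M * 17 * H) * B * (1 / (real n + 1)\<^sup>2)"
    if "smooth f" "B > 0" "decay_bound M B f" for f n B
    using that by (simp add: mult_ac)
  moreover have "C * 2 ^ M * 17 * H > 0" using C(1) H(1) by simp
  ultimately show thesis using that by blast
qed

text \<open>The extension is the series of the values of \<open>Y\<close> on the pieces. For a test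
  function this series is finite, and it differs from \<open>Y f\<close> by the value on a remainder
  that vanishes on \<open>[0, \<infinity>)\<close>, which is 0 by causality.\<close>

lemma tempered: "Y \<in> tempered_distributions"
proof -
  obtain h where h: "smooth h" "supp_in (-3) (-1) h"
    and h_sum: "\<And>x m. -2 \<le> x \<Longrightarrow> x \<le> real m - 3 \<Longrightarrow> (\<Sum>n<m. h (x - real n)) = 1"
    using smooth_partition_exists by blast
  obtain C M where C: "C > 0" "\<And>f n B. smooth f \<Longrightarrow> B > 0 \<Longrightarrow> decay_bound M B f \<Longrightarrow>
    cmod (Y (\<lambda>x. f x * h (x - real n))) \<le> C * B * (1 / (real n + 1)\<^sup>2)"
    using Y_piece_bound[OF h] by blast
  define P where "P f n = Y (\<lambda>x. f x * h (x - real n))" for f and n :: nat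
  define T where "T = (\<lambda>f\<in>schwartz_functions. \<Sum>n. P f n)"
  have sm: "smooth f" if "f \<in> schwartz_functions" for f
    using that by (simp add: schwartz_functions_def)
  have piece: "(\<lambda>x. f x * h (x - real n)) \<in> test_functions" if "smooth f" for f n
  proof (rule test_functionI)
    show "smooth (\<lambda>x. f x * h (x - real n))"
      using smooth_mult(1)[OF that smooth_affine(1)[OF h(1), of 1 "- real n"]] by simp
    show "supp_in (real n - 3) (real n - 1) (\<lambda>x. f x * h (x - real n))"
      using supp_in_shift[OF h(2), of "real n"] by (simp add: supp_in_def)
  qed
  have inverse_squares: "summable (\<lambda>n. 1 / (real n + 1)\<^sup>2)"
    using inverse_squares_sums by (simp add: sums_iff add.commute)
  define D where "D = (\<Sum>n. 1 / (real n + 1)\<^sup>2)"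
  have D: "D \<ge> 0" unfolding D_def by (rule suminf_nonneg[OF inverse_squares]) simp
  have summ: "summable (\<lambda>n. C * B * (1 / (real n + 1)\<^sup>2))" for B
    by (rule summable_mult[OF inverse_squares])
  have P_norm: "cmod (P f n) \<le> C * B * (1 / (real n + 1)\<^sup>2)" if "smooth f" "B > 0" "decay_bound M B f" for f n B
    unfolding P_def by (rule C(2)[OF that])
  have P_summable: "summable (P f)" if f: "f \<in> schwartz_functions" for f
  proof -
    obtain B where "B > 0" "decay_bound M B f" by (rule schwartz_decay_bound[OF f])
    then show ?thesis
      using P_norm[OF sm[OF f]] by (intro summable_comparison_test'[OF summ, of 0 _ B]) auto
  qed
  have P_suminf: "cmod (\<Sum>n. P f n) \<le> C * D * B" if "smooth f" "B > 0" "decay_bound M B f" for f B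
  proof -
    have "cmod (\<Sum>n. P f n) \<le> (\<Sum>n. C * B * (1 / (real n + 1)\<^sup>2))"
      by (rule norm_suminf_le[OF P_norm[OF that] summ])
    also have "\<dots> = C * B * D"
      unfolding D_def by (rule suminf_mult[OF inverse_squares])
    finally show ?thesis by (simp add: mult_ac)
  qed
  have P_add: "P (\<lambda>x. f x + g x) n = P f n + P g n" if "smooth f" "smooth g" for f g n
    using distribution_add[OF Y piece piece, OF that, of n n] by (simp add: P_def distrib_right)
  have P_cmult: "P (\<lambda>x. a * f x) n = a * P f n" if "smooth f" for f a n
    using distribution_cmult[OF Y piece[OF that, of n], of a] by (simp add: P_def mult.assoc)
  have P_diff: "P (\<lambda>x. f x - g x) n = P f n - P g n" if "smooth f" "smooth g" for f g n
    using distribution_diff[OF Y piece piece, OF that, of n n] by (simp add: P_def left_diff_distrib)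
  have schwartz_add: "(\<lambda>x. f x + g x) \<in> schwartz_functions"
    if "f \<in> schwartz_functions" "g \<in> schwartz_functions" for f g
    using that unfolding schwartz_functions_def
    by (auto simp: smooth_add scaleR_add_right intro!: bounded_plus_comp)
  have schwartz_cmult: "(\<lambda>x. a * f x) \<in> schwartz_functions"
    if "f \<in> schwartz_functions" for a f
  proof -
    have "bounded (range (\<lambda>x. (x ^ j) *\<^sub>R (a * nth_deriv k f x)))" for j k
      using that bounded_linear_image[OF _ bounded_linear_mult_right[of a], of "range (\<lambda>x. (x ^ j) *\<^sub>R nth_deriv k f x)"]
      by (simp add: schwartz_functions_def image_image)
    then show ?thesis using that by (simp add: schwartz_functions_def smooth_cmult)
  qed
  have "T \<in> schwartz_dual"
    unfolding schwartz_dual_def linear_functional_on_def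
  proof (intro CollectI conjI ballI allI impI)
    show "T \<in> extensional schwartz_functions" by (simp add: T_def)
  next
    fix f g assume "f \<in> schwartz_functions" "g \<in> schwartz_functions"
    moreover from this have "P (\<lambda>x. f x + g x) = (\<lambda>n. P f n + P g n)"
      by (simp add: fun_eq_iff P_add sm)
    ultimately show "T (\<lambda>x. f x + g x) = T f + T g"
      by (simp add: T_def schwartz_add suminf_add P_summable)
  next
    fix a f assume "f \<in> schwartz_functions"
    moreover from this have "P (\<lambda>x. a * f x) = (\<lambda>n. a * P f n)"
      by (simp add: fun_eq_iff P_cmult sm)
    ultimately show "T (\<lambda>x. a * f x) = a * T f"
      by (simp add: T_def schwartz_cmult suminf_mult P_summable)
  next
    fix \<Phi> \<phi> assume lim: "tendsto_schwartz \<Phi> \<phi>"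
    then have \<Phi>: "\<Phi> n \<in> schwartz_functions" "\<phi> \<in> schwartz_functions" for n
      by (auto simp: tendsto_schwartz_def)
    show "(\<lambda>n. T (\<Phi> n)) \<longlonglongrightarrow> T \<phi>"
    proof (rule tendstoI)
      fix e :: real assume "e > 0"
      \<comment> \<open>The added 1 keeps the denominator positive and makes the final inequality
        strict.\<close>
      define e' where "e' = e / (C * D + 1)"
      have CD: "C * D + 1 > 0" using C(1) D by (simp add: add_nonneg_pos)
      have "e' > 0" using CD \<open>e > 0\<close> by (simp add: e'_def)
      from tendsto_schwartz_decay_bound[OF lim this, of M]
      show "\<forall>\<^sub>F n in sequentially. dist (T (\<Phi> n)) (T \<phi>) < e"
      proof eventually_elim
        case (elim n)
        have "T (\<Phi> n) - T \<phi> = (\<Sum>k. P (\<lambda>x. \<Phi> n x - \<phi> x) k)"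
        proof -
          have "P (\<lambda>x. \<Phi> n x - \<phi> x) = (\<lambda>k. P (\<Phi> n) k - P \<phi> k)"
            by (simp add: fun_eq_iff P_diff sm \<Phi>)
          then show ?thesis by (simp add: T_def \<Phi> suminf_diff P_summable)
        qed
        then have "cmod (T (\<Phi> n) - T \<phi>) \<le> C * D * e'"
          using P_suminf[OF smooth_diff(1)[OF sm sm, OF \<Phi>] \<open>e' > 0\<close> elim] by simp
        also have "\<dots> < (C * D + 1) * e'" using \<open>e' > 0\<close> by simp
        also have "\<dots> = e" using CD by (simp add: e'_def)
        finally show ?case by (simp add: dist_norm)
      qed
    qed
  qed
  moreover have "Y = restrict T test_functions"
  proof (rule extensionalityI)
    show "Y \<in> extensional test_functions" using Y by (simp add: distributions_def)
    show "restrict T test_functions \<in> extensional test_functions" by simp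
    fix f assume f: "f \<in> test_functions"
    note sf = test_function_smooth[OF f]
    obtain r where r: "supp_in (-r) r f" by (rule test_function_supp[OF f])
    \<comment> \<open>Pieces with \<open>n \<ge> m\<close> start beyond \<open>r\<close> and miss
      \<open>f\<close>; on \<open>0 \<le> x \<le> r\<close> the first \<open>m\<close> pieces sum to
      1.\<close>
    obtain m where m: "r + 4 \<le> real m" using real_arch_simple by blast
    have "P f n = 0" if "n \<notin> {..<m}" for n
    proof -
      have "real m \<le> real n" using that by simp
      then have "f x * h (x - real n) = 0" for x
        using r h(2) m by (cases "x \<le> r") (auto simp: supp_in_def)
      then have "(\<lambda>x. f x * h (x - real n)) = (\<lambda>x. 0)" by blast
      then show ?thesis by (simp only: P_def distribution_0[OF Y])
    qed
    then have "(\<Sum>n. P f n) = (\<Sum>n<m. P f n)"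
      by (intro suminf_finite) auto
    \<comment> \<open>Membership in the test functions is carried through the induction because
      linearity of \<open>Y\<close> requires it.\<close>
    moreover have rest: "Y f = Y (\<lambda>x. f x - (\<Sum>n<k. f x * h (x - real n))) + (\<Sum>n<k. P f n) \<and>
      (\<lambda>x. f x - (\<Sum>n<k. f x * h (x - real n))) \<in> test_functions" for k
    proof (induction k)
      case (Suc k)
      have e: "(\<lambda>x. f x - (\<Sum>n<Suc k. f x * h (x - real n))) =
          (\<lambda>x. (f x - (\<Sum>n<k. f x * h (x - real n))) - f x * h (x - real k))"
        by (simp add: algebra_simps)
      show ?case
        unfolding e using Suc test_diff[OF conjunct2[OF Suc] piece[OF sf]]
          distribution_diff[OF Y conjunct2[OF Suc] piece[OF sf]]
        by (simp add: P_def)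
    qed (use f in simp)
    \<comment> \<open>The remainder may be nonzero to the left of 0, where the pieces do not cover
      \<open>f\<close>.\<close>
    moreover have "Y (\<lambda>x. f x - (\<Sum>n<m. f x * h (x - real n))) = 0"
    proof (rule Y_causal)
      show "(\<lambda>x. f x - (\<Sum>n<m. f x * h (x - real n))) \<in> test_functions"
        using rest by blast
      show "f x - (\<Sum>n<m. f x * h (x - real n)) = 0" if "0 \<le> x" for x
      proof (cases "x \<le> r")
        case True
        then have "(\<Sum>n<m. h (x - real n)) = 1" using that m by (intro h_sum) auto
        then show ?thesis by (simp add: sum_distrib_left[symmetric])
      qed (use r in \<open>auto simp: supp_in_def\<close>)
    qed
    ultimately have "T f = Y f"
      using test_function_schwartz[OF f] rest[of m] by (simp add: T_def)
    then show "Y f = restrict T test_functions f" using f by simp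
  qed
  ultimately show ?thesis by (simp add: tempered_distributions_def)
qed

end

theorem theorem4p1:
  fixes Y :: "(real \<Rightarrow> complex) \<Rightarrow> complex"
    and R :: "((real \<Rightarrow> complex) \<Rightarrow> complex) \<rightharpoonup> ((real \<Rightarrow> complex) \<Rightarrow> complex)"
  assumes "Y \<in> distributions"
    and "R = convolution_operator Y"
    and "pseudo_passive_d0 R"
  shows "dist_support Y \<subseteq> {0..} \<and> Y \<in> tempered_distributions"
proof -
  obtain N c where *: "\<And>t f. f \<in> test_functions \<Longrightarrow> \<exists>\<psi>\<in>L1_loc.
        R (dist_of f) = Some (dist_of \<psi>) \<and>
        Re (LINT \<tau>:{..t}|lebesgue. cnj (f \<tau>) * \<psi> \<tau>)
          \<ge> (\<Sum>j\<le>N. c j * (LINT \<tau>:{..t}|lebesgue. (cmod (nth_deriv j f \<tau>))\<^sup>2))"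
    using assms(3) unfolding pseudo_passive_d0_def by blast
  interpret passive_distribution Y N c
  proof
    fix t f assume f: "f \<in> test_functions"
    then obtain \<psi> where \<psi>: "convolution_operator Y (dist_of f) = Some (dist_of \<psi>)"
      "(\<Sum>j\<le>N. c j * (LINT \<tau>:{..t}|lebesgue. (cmod (nth_deriv j f \<tau>))\<^sup>2))
        \<le> Re (LINT \<tau>:{..t}|lebesgue. cnj (f \<tau>) * \<psi> \<tau>)"
      using *[of f t] assms(2) by auto
    then show "\<exists>\<psi>. (\<forall>g\<in>test_functions. Y (corr f g) = (LINT x|lebesgue. \<psi> x * g x)) \<and>
        (\<Sum>j\<le>N. c j * (LINT \<tau>:{..t}|lebesgue. (cmod (nth_deriv j f \<tau>))\<^sup>2))
          \<le> Re (LINT \<tau>:{..t}|lebesgue. cnj (f \<tau>) * \<psi> \<tau>)"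
      using convolution_operator_dist_of[OF \<psi>(1) f] by blast
  qed (rule assms(1))
  show ?thesis using dist_support_causal tempered by blast
qed

end
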